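(* Let $\varepsilon>0$, $\delta\ge0$, $\sigma\in(0,1/2)$. Let $\hat x$ be the output of Algorithm 1 (described in the context) run with accuracy $\varepsilon$, constant stepsize $\eta=\varepsilon/M^2$, $\delta$-approximations $g^{(l)}_\delta$ of the constraints, and a number of steps $$N\ \ge\ N_0'=\frac{128\,\overline\Theta_0^2M^2\bigl(17\log(2/\sigma)+2\kappa(E^* )\bigr)}{\varepsilon^2},\qquad \overline\Theta_0^2=\sup_{y\in Q}\bigl(d(y)-d(x^0)\bigr),$$ and let $\hat\lambda\in\mathbb R^m_+$ be given by $\hat\lambda_l=\frac1{|I|}\sum_{k\in J}\mathbb I\{l=l(k)\}$. Then $(\hat x,\hat\lambda)$ is a primal-dual $(\varepsilon,\varepsilon+2\delta,\sigma)$-solution, i.e. with probability at least $1-\sigma$, $$\Delta(\hat x,\hat\lambda)=f(\hat x)-\phi(\hat\lambda)\le\varepsilon\quad\text{and}\quad g^{(l)}(\hat x)\le\varepsilon+2\delta\ \ \text{for all } l\in[m].$$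
   Context: Setting. $(E,\|\cdot\|)$ is a finite-dimensional normed space, $E^*$ its dual with dual norm $\|v\|_*=\sup_{\|x\|=1}\langle v,x\rangle$, $Q\subseteq E$ a convex compact set, $[m]=\{1,\dots,m\}$. The problem is $\min_{x\in Q}f(x)$ subject to $g^{(l)}(x)\le 0$ for all $l\in[m]$, where $f,g^{(l)}:Q\to\mathbb R$ are convex, with subgradients $\nabla f(x),\nabla g^{(l)}(x)$ existing at every $x\in Q$. Slater's condition is assumed: there is $x\in Q$ with $g^{(l)}(x)<0$ for all $l\in[m]$. Dual problem: maximize over $\lambda\in\mathbb R^m_+$ the function $\phi(\lambda)=\min_{x\in Q}\{f(x)+\sum_{l=1}^m\lambda_lg^{(l)}(x)\}$. The duality gap is $\Delta(x,\lambda)=f(x)-\phi(\lambda)$. Assumptions (with $M>0$): (A1) $f$ and all $g^{(l)}$ are $M$-Lipschitz with respect to $\|\cdot\|$; (A2) the stochastic subgradients are unbiased: $\mathbb E\nabla f(x,\xi)=\nabla f(x)$, $\mathbb E\nabla g^{(l)}(x,\xi_{(l)})=\nabla g^{(l)}(x)$; (A3) $\|\nabla f(x,\xi)\|_*\le M$ and $\|\nabla g^{(l)}(x,\xi_{(l)})\|_*\le M$ almost surely. The samples $\xi^k,\xi^k_{(l)}$ used at iteration $k$ are drawn afresh, independently of the past. Constraint values are accessible only through $\delta$-approximations $g^{(l)}_\delta:Q\to\mathbb R$, i.e. $|g^{(l)}_\delta(x)-g^{(l)}(x)|\le\delta$ for all $x\in Q$. Prox-structure. $d:Q\to\mathbb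 R$ is a continuous function, 1-strongly convex with respect to $\|\cdot\|$, admitting a continuous selection of subgradients $\nabla d(x)$ where they exist. $V(x,y)=d(y)-d(x)-\langle\nabla d(x),y-x\rangle$ and $\operatorname{Mirr}(x,v)=\arg\min_{y\in Q}\{\langle v,y\rangle+V(x,y)\}$ for $v\in E^*$. Algorithm 1 (inputs: $\varepsilon>0$, number of steps $N$, stepsize $\eta=\varepsilon/M^2$). Set $x^0=\arg\min_{x\in Q}d(x)$, $I=J=\emptyset$. For $k=0,\dots,N-1$: if $g^{(l)}_\delta(x^k)\le\varepsilon+\delta$ for all $l\in[m]$, set $x^{k+1}=\operatorname{Mirr}(x^k,\eta\nabla f(x^k,\xi^k))$ and add $k$ to $I$; otherwise let $l(k)\in\arg\max_{l\in[m]}g^{(l)}_\delta(x^k)$, set $x^{k+1}=\operatorname{Mirr}(x^k,\eta\nabla g^{(l(k))}(x^k,\xi^k_{(l(k))}))$ and add $k$ to $J$. Return $\hat x=\frac1{|I|}\sum_{k\in I}x^k$. $\kappa(E^* )$ is the constant of Nemirovski's inequality for $(E^*,\|\cdot\|_* )$: the smallest $\kappa$ such that $\mathbb E\|\sum_iX_i\|_*^2\le\kappa\sum_i\mathbb E\|X_i\|_*^2$ for every finite family of independent zero-mean square-integrable random vectors $X_i$ in $E^*$. $\mathbb I$ denotes an indicator. *)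

theory Defs
  imports "HOL-Probability.Probability"
begin

text \<open>
  A finite-dimensional normed space is a type of class \<^class>\<open>euclidean_space\<close> together with an
  arbitrary norm \<open>p\<close> on it; the norm of the type class only provides the (unique) linear topology.
  The dual space is represented on the same type through the pairing \<open>\<langle>v, x\<rangle> = v \<bullet> x\<close> and
  carries the norm \<open>dual_norm p\<close>.
\<close>

definition is_norm :: "('a::real_vector \<Rightarrow> real) \<Rightarrow> bool" where
  "is_norm p \<longleftrightarrow>
     (\<forall>x. p x = 0 \<longleftrightarrow> x = 0) \<and>
     (\<forall>c x. p (c *\<^sub>R x) = \<bar>c\<bar> * p x) \<and>
     (\<forall>x y. p (x + y) \<le> p x + p y)"

definition dual_norm :: "('a::real_inner \<Rightarrow> real) \<Rightarrow> 'a \<Rightarrow> real" where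
  "dual_norm p v = (SUP x\<in>{x. p x = 1}. v \<bullet> x)"

definition lipschitz_wrt :: "('a::real_vector \<Rightarrow> real) \<Rightarrow> real \<Rightarrow> 'a set \<Rightarrow> ('a \<Rightarrow> real) \<Rightarrow> bool" where
  "lipschitz_wrt p L S f \<longleftrightarrow> (\<forall>x\<in>S. \<forall>y\<in>S. \<bar>f x - f y\<bar> \<le> L * p (x - y))"

definition is_subgradient :: "'a::real_inner set \<Rightarrow> ('a \<Rightarrow> real) \<Rightarrow> 'a \<Rightarrow> 'a \<Rightarrow> bool" where
  "is_subgradient S f x v \<longleftrightarrow> (\<forall>y\<in>S. f y \<ge> f x + v \<bullet> (y - x))"

definition strongly_convex_wrt ::
  "('a::real_vector \<Rightarrow> real) \<Rightarrow> real \<Rightarrow> 'a set \<Rightarrow> ('a \<Rightarrow> real) \<Rightarrow> bool" where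
  "strongly_convex_wrt p \<mu> S f \<longleftrightarrow> convex S \<and>
     (\<forall>x\<in>S. \<forall>y\<in>S. \<forall>u\<ge>0. \<forall>v\<ge>0. u + v = 1 \<longrightarrow>
        f (u *\<^sub>R x + v *\<^sub>R y) \<le> u * f x + v * f y - \<mu> / 2 * u * v * (p (x - y))\<^sup>2)"

text \<open>
  The prox-structure: \<open>d\<close> is the prox-function and \<open>gd\<close> the selection of its subgradients, which is
  only required to be meaningful at those points of \<open>Q\<close> at which a subgradient exists.
\<close>

definition subdiff_domain :: "'a::real_inner set \<Rightarrow> ('a \<Rightarrow> real) \<Rightarrow> 'a set" where
  "subdiff_domain S f = {x\<in>S. \<exists>v. is_subgradient S f x v}"

definition prox_function ::
  "('a::euclidean_space \<Rightarrow> real) \<Rightarrow> 'a set \<Rightarrow> ('a \<Rightarrow> real) \<Rightarrow> ('a \<Rightarrow> 'a) \<Rightarrow> bool" where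
  "prox_function p Q d gd \<longleftrightarrow>
     continuous_on Q d \<and> strongly_convex_wrt p 1 Q d \<and>
     (\<forall>x\<in>subdiff_domain Q d. is_subgradient Q d x (gd x)) \<and>
     continuous_on (subdiff_domain Q d) gd"

definition bregman :: "('a::real_inner \<Rightarrow> real) \<Rightarrow> ('a \<Rightarrow> 'a) \<Rightarrow> 'a \<Rightarrow> 'a \<Rightarrow> real" where
  "bregman d gd x y = d y - d x - gd x \<bullet> (y - x)"

text \<open>
  On a nonempty compact convex \<open>Q\<close> the minimizers selected by \<^const>\<open>arg_min_on\<close> below exist and are
  unique, since \<open>d\<close> is continuous and strongly convex.
\<close>

definition mirr :: "'a::real_inner set \<Rightarrow> ('a \<Rightarrow> real) \<Rightarrow> ('a \<Rightarrow> 'a) \<Rightarrow> 'a \<Rightarrow> 'a \<Rightarrow> 'a" where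
  "mirr Q d gd x v = arg_min_on (\<lambda>y. v \<bullet> y + bregman d gd x y) Q"

definition prox_center :: "'a set \<Rightarrow> ('a \<Rightarrow> real) \<Rightarrow> 'a" where
  "prox_center Q d = arg_min_on d Q"

definition Theta_sq :: "'a set \<Rightarrow> ('a \<Rightarrow> real) \<Rightarrow> real" where
  "Theta_sq Q d = (SUP y\<in>Q. d y - d (prox_center Q d))"

text \<open>
  The constraints are indexed by \<open>{1..m}\<close>; a vector of \<open>m\<close> multipliers is a function on \<open>nat\<close> of
  which only the values on \<open>{1..m}\<close> matter.
\<close>

definition dual_fun ::
  "'a set \<Rightarrow> ('a \<Rightarrow> real) \<Rightarrow> nat \<Rightarrow> (nat \<Rightarrow> 'a \<Rightarrow> real) \<Rightarrow> (nat \<Rightarrow> real) \<Rightarrow> real" where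
  "dual_fun Q f m g lam = (INF x\<in>Q. f x + (\<Sum>l=1..m. lam l * g l x))"

definition duality_gap ::
  "'a set \<Rightarrow> ('a \<Rightarrow> real) \<Rightarrow> nat \<Rightarrow> (nat \<Rightarrow> 'a \<Rightarrow> real) \<Rightarrow> 'a \<Rightarrow> (nat \<Rightarrow> real) \<Rightarrow> real" where
  "duality_gap Q f m g x lam = f x - dual_fun Q f m g lam"

definition primal_dual_approx ::
  "'a set \<Rightarrow> ('a \<Rightarrow> real) \<Rightarrow> nat \<Rightarrow> (nat \<Rightarrow> 'a \<Rightarrow> real) \<Rightarrow> real \<Rightarrow> real \<Rightarrow> 'a \<Rightarrow> (nat \<Rightarrow> real) \<Rightarrow> bool" where
  "primal_dual_approx Q f m g e\<^sub>f e\<^sub>g x lam \<longleftrightarrow>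
     x \<in> Q \<and> (\<forall>l\<in>{1..m}. 0 \<le> lam l) \<and>
     duality_gap Q f m g x lam \<le> e\<^sub>f \<and> (\<forall>l\<in>{1..m}. g l x \<le> e\<^sub>g)"

text \<open>
  One realization of the algorithm. \<open>Gf x s\<close> and \<open>Gg l x t\<close> are the stochastic subgradients,
  \<open>h l\<close> is the approximation of the \<open>l\<close>-th constraint and \<open>\<theta>\<close> the threshold against which it is
  tested, \<open>s k\<close> and \<open>t k l\<close> are the samples available at step \<open>k\<close>, \<open>c k\<close> is the index of the
  constraint chosen at a nonproductive step \<open>k\<close> (any maximizer; unconstrained at productive steps),
  and \<open>x k\<close> is the \<open>k\<close>-th iterate.
\<close>

definition productive :: "nat \<Rightarrow> (nat \<Rightarrow> 'a \<Rightarrow> real) \<Rightarrow> real \<Rightarrow> 'a \<Rightarrow> bool" where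
  "productive m h \<theta> y \<longleftrightarrow> (\<forall>l\<in>{1..m}. h l y \<le> \<theta>)"

definition mirror_descent_run ::
  "'a::real_inner set \<Rightarrow> ('a \<Rightarrow> real) \<Rightarrow> ('a \<Rightarrow> 'a) \<Rightarrow> ('a \<Rightarrow> 's \<Rightarrow> 'a) \<Rightarrow> nat \<Rightarrow>
   (nat \<Rightarrow> 'a \<Rightarrow> 't \<Rightarrow> 'a) \<Rightarrow> (nat \<Rightarrow> 'a \<Rightarrow> real) \<Rightarrow> real \<Rightarrow> real \<Rightarrow> nat \<Rightarrow>
   (nat \<Rightarrow> 's) \<Rightarrow> (nat \<Rightarrow> nat \<Rightarrow> 't) \<Rightarrow> (nat \<Rightarrow> nat) \<Rightarrow> (nat \<Rightarrow> 'a) \<Rightarrow> bool" where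
  "mirror_descent_run Q d gd Gf m Gg h \<theta> \<eta> N s t c x \<longleftrightarrow>
     x 0 = prox_center Q d \<and>
     (\<forall>k<N.
        if productive m h \<theta> (x k)
        then x (Suc k) = mirr Q d gd (x k) (\<eta> *\<^sub>R Gf (x k) (s k))
        else is_arg_max (\<lambda>l. h l (x k)) (\<lambda>l. l \<in> {1..m}) (c k) \<and>
             x (Suc k) = mirr Q d gd (x k) (\<eta> *\<^sub>R Gg (c k) (x k) (t k (c k))))"

definition productive_steps ::
  "nat \<Rightarrow> (nat \<Rightarrow> 'a \<Rightarrow> real) \<Rightarrow> real \<Rightarrow> nat \<Rightarrow> (nat \<Rightarrow> 'a) \<Rightarrow> nat set" where
  "productive_steps m h \<theta> N x = {k. k < N \<and> productive m h \<theta> (x k)}"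

definition nonproductive_steps ::
  "nat \<Rightarrow> (nat \<Rightarrow> 'a \<Rightarrow> real) \<Rightarrow> real \<Rightarrow> nat \<Rightarrow> (nat \<Rightarrow> 'a) \<Rightarrow> nat set" where
  "nonproductive_steps m h \<theta> N x = {k. k < N \<and> \<not> productive m h \<theta> (x k)}"

definition primal_output :: "nat set \<Rightarrow> (nat \<Rightarrow> 'a::real_vector) \<Rightarrow> 'a" where
  "primal_output I x = (1 / real (card I)) *\<^sub>R (\<Sum>k\<in>I. x k)"

definition dual_output :: "nat set \<Rightarrow> nat set \<Rightarrow> (nat \<Rightarrow> nat) \<Rightarrow> nat \<Rightarrow> real" where
  "dual_output I J c l = 1 / real (card I) * (\<Sum>k\<in>J. of_bool (l = c k))"

text \<open>
  Nemirovski's inequality for a norm \<open>q\<close>. Probability spaces over the sample type \<open>nat \<Rightarrow> 'a\<close> suffice: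
  every finite family of random vectors of any probability space has the same joint law as the
  coordinate maps for a suitable probability measure on \<open>nat \<Rightarrow> 'a\<close>.
\<close>

definition nemirovski_bound :: "('a::euclidean_space \<Rightarrow> real) \<Rightarrow> real \<Rightarrow> bool" where
  "nemirovski_bound q \<kappa> \<longleftrightarrow> 0 \<le> \<kappa> \<and>
     (\<forall>(P :: (nat \<Rightarrow> 'a) measure) (X :: nat \<Rightarrow> (nat \<Rightarrow> 'a) \<Rightarrow> 'a) (n :: nat).
        prob_space P \<longrightarrow>
        prob_space.indep_vars P (\<lambda>_. borel) X {..<n} \<longrightarrow>
        (\<forall>i<n. has_bochner_integral P (X i) 0 \<and> integrable P (\<lambda>\<omega>. (q (X i \<omega>))\<^sup>2)) \<longrightarrow>
        (\<integral>\<omega>. (q (\<Sum>i<n. X i \<omega>))\<^sup>2 \<partial>P) \<le> \<kappa> * (\<Sum>i<n. \<integral>\<omega>. (q (X i \<omega>))\<^sup>2 \<partial>P))"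

definition nemirovski_const :: "('a::euclidean_space \<Rightarrow> real) \<Rightarrow> real" where
  "nemirovski_const q = Inf {\<kappa>. nemirovski_bound q \<kappa>}"

end

theory Submission
  imports Defs
begin

text \<open>
  The optimality condition of the mirror step gives the usual regret bound for the linearized losses along
  the iterates. The loss at a point \<open>y\<close> then differs from its stochastic version by the noise term
  \<open>\<Sum>k. noise k \<bullet> (y - x k)\<close>, and the supremum over \<open>y \<in> Q\<close> is handled by a second mirror descent \<open>z\<close>
  driven by the noise alone: its deterministic regret bounds \<open>\<Sum>k. noise k \<bullet> (y - z k)\<close>, while
  \<open>\<Sum>k. noise k \<bullet> (z k - x k)\<close> is a scalar martingale with bounded increments, controlled by Hoeffding's
  lemma. This is sharp enough for the stated number of steps; the Nemirovski constant only enters through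
  its nonnegativity. Once the regret is at most \<open>\<epsilon> N\<close>, the strict inequality \<open>g > \<epsilon>\<close> at nonproductive
  steps yields the duality gap, and together with Slater's condition the existence of a productive step.
\<close>

section \<open>Norms and the Nemirovski constant\<close>

text \<open>The minimizer \<open>y\<close> behind the dual function depends on the multipliers,
  hence on all samples, so \<open>noise k \<bullet> (y - x k)\<close> has no martingale structure at
  that \<open>y\<close>. The iterates \<open>x k\<close> and \<open>aux \<gamma> k\<close>, in
  contrast, are both determined before step \<open>k\<close>. The budget
  \<open>\<epsilon> * N\<close> is split into 1/2 for the stepsize term of the main descent, 1/4 for
  that of the auxiliary one and 1/6 for the martingale; the remaining 1/12 covers the
  \<open>Theta_sq\<close> terms. Two obstacles shape the rest. The selection \<open>gd\<close> is a
  true subgradient only where one exists, so iterates must be kept in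
  \<open>subdiff_domain Q d\<close> and optimality must be proved for the selected subgradient
  itself. Moreover the past decides which oracle is called, and the oracles have different sample
  spaces; they are hidden behind one predicate indexed by \<open>{..m}\<close>, in which integrals
  against arbitrary weights measurable in the past take the place of conditional
  expectations.\<close>

lemma is_norm_nonneg: "is_norm p \<Longrightarrow> 0 \<le> p x"
proof -
  assume n: "is_norm p"
  have "p (x + (-1) *\<^sub>R x) \<le> p x + p ((-1) *\<^sub>R x)" using n unfolding is_norm_def by blast
  moreover have "p ((-1) *\<^sub>R x) = p x" using n unfolding is_norm_def by (metis abs_minus_cancel abs_one mult_1)
  moreover have "p (x + (-1) *\<^sub>R x) = 0" using n unfolding is_norm_def by simp
  ultimately show ?thesis by linarith
qed

lemma is_norm_zero: "is_norm p \<Longrightarrow> p x = 0 \<longleftrightarrow> x = 0"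
  unfolding is_norm_def by blast

lemma is_norm_scale: "is_norm p \<Longrightarrow> p (c *\<^sub>R x) = \<bar>c\<bar> * p x"
  unfolding is_norm_def by blast

lemma is_norm_triangle: "is_norm p \<Longrightarrow> p (x + y) \<le> p x + p y"
  unfolding is_norm_def by blast

lemma is_norm_minus: "is_norm p \<Longrightarrow> p (- x) = p x"
  using is_norm_scale[of p "-1" x] by simp

lemma is_norm_minus_commute: "is_norm p \<Longrightarrow> p (x - y) = p (y - x)"
  using is_norm_minus[of p "x - y"] by simp

lemma is_norm_sum:
  assumes "finite A" and "is_norm p"
  shows "p (\<Sum>i\<in>A. h i) \<le> (\<Sum>i\<in>A. p (h i))"
  using assms
proof (induction A rule: finite_induct)
  case empty
  then show ?case using is_norm_zero[of p 0] by simp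
next
  case (insert a A)
  then show ?case using is_norm_triangle[of p "h a" "sum h A"] by simp
qed

lemma is_norm_upper:
  fixes p :: "'a::euclidean_space \<Rightarrow> real"
  assumes "is_norm p"
  shows "p x \<le> (\<Sum>b\<in>Basis. p b) * norm x"
proof -
  have "p x = p (\<Sum>b\<in>Basis. (x \<bullet> b) *\<^sub>R b)" by (simp add: euclidean_representation)
  also have "\<dots> \<le> (\<Sum>b\<in>Basis. p ((x \<bullet> b) *\<^sub>R b))" by (rule is_norm_sum[OF finite_Basis assms])
  also have "\<dots> = (\<Sum>b\<in>Basis. \<bar>x \<bullet> b\<bar> * p b)" by (simp add: is_norm_scale[OF assms])
  also have "\<dots> \<le> (\<Sum>b\<in>Basis. norm x * p b)"
    by (intro sum_mono mult_right_mono is_norm_nonneg assms Basis_le_norm)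
  finally show ?thesis by (simp add: sum_distrib_left mult.commute)
qed

lemma is_norm_continuous:
  fixes p :: "'a::euclidean_space \<Rightarrow> real"
  assumes "is_norm p"
  shows "continuous_on A p"
proof -
  define C where "C = (\<Sum>b\<in>Basis. p (b :: 'a))"
  have C: "0 \<le> C" unfolding C_def by (intro sum_nonneg is_norm_nonneg assms)
  have "C-lipschitz_on A p"
  proof (rule lipschitz_onI)
    fix x y
    have "p x \<le> p y + p (x - y)" using is_norm_triangle[OF assms, of y "x - y"] by simp
    moreover have "p y \<le> p x + p (x - y)" 
      using is_norm_triangle[OF assms, of x "y - x"] is_norm_minus_commute[OF assms, of x y] by simp
    ultimately have "\<bar>p x - p y\<bar> \<le> p (x - y)" by linarith
    also have "\<dots> \<le> C * norm (x - y)" unfolding C_def by (rule is_norm_upper[OF assms])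
    finally show "dist (p x) (p y) \<le> C * dist x y" by (simp add: dist_norm)
  qed (rule C)
  then show ?thesis by (rule lipschitz_on_continuous_on)
qed

text \<open>The lower half of norm equivalence: \<open>p\<close> is continuous and positive on the
  compact Euclidean unit sphere, so its minimum there serves as the constant.\<close>

lemma is_norm_lower:
  fixes p :: "'a::euclidean_space \<Rightarrow> real"
  assumes "is_norm p"
  obtains e where "e > 0" "\<And>x. e * norm x \<le> p x"
proof -
  obtain b :: 'a where "b \<in> Basis" using nonempty_Basis by blast
  then have "sphere (0::'a) 1 \<noteq> {}" by (auto intro!: exI[of _ b])
  then obtain u where u: "u \<in> sphere 0 1" "\<And>y. y \<in> sphere 0 1 \<Longrightarrow> p u \<le> p y"
    using continuous_attains_inf[OF compact_sphere _ is_norm_continuous[OF assms]] by metis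
  have "u \<noteq> 0" using u(1) by auto
  then have pos: "p u > 0" using is_norm_nonneg[OF assms, of u] is_norm_zero[OF assms, of u] by linarith
  have "p u * norm x \<le> p x" for x
  proof (cases "x = 0")
    case False
    then have "p u \<le> p ((1 / norm x) *\<^sub>R x)" by (intro u(2)) simp
    also have "\<dots> = p x / norm x" by (simp add: is_norm_scale[OF assms])
    finally show ?thesis using False by (simp add: field_simps)
  qed (simp add: is_norm_nonneg[OF assms])
  with pos show ?thesis using that by blast
qed

lemma is_norm_sphere_nonempty:
  fixes p :: "'a::euclidean_space \<Rightarrow> real"
  assumes "is_norm p"
  shows "{x. p x = 1} \<noteq> {}"
proof -
  obtain b :: 'a where "b \<in> Basis" using nonempty_Basis by blast
  then have "b \<noteq> 0" by auto
  then have "p ((1 / p b) *\<^sub>R b) = 1"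
    using is_norm_nonneg[OF assms, of b] is_norm_zero[OF assms, of b] by (simp add: is_norm_scale[OF assms])
  then show ?thesis by blast
qed

text \<open>A real supremum is informative only for a set bounded above; norm equivalence bounds the
  Euclidean length of the points with \<open>p x = 1\<close>.\<close>

lemma dual_norm_bdd_above:
  fixes p :: "'a::euclidean_space \<Rightarrow> real"
  assumes "is_norm p"
  shows "bdd_above ((\<bullet>) v ` {x. p x = 1})"
proof -
  obtain e where e: "e > 0" "\<And>x. e * norm x \<le> p x" using is_norm_lower[OF assms] by blast
  have "v \<bullet> x \<le> norm v * (1 / e)" if "p x = 1" for x
  proof -
    have "v \<bullet> x \<le> norm v * norm x" by (rule norm_cauchy_schwarz)
    also have "norm x \<le> 1 / e" using e(1) e(2)[of x] that by (simp add: field_simps)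
    finally show ?thesis by (simp add: mult_left_mono)
  qed
  then show ?thesis by (intro bdd_aboveI2) auto
qed

lemma inner_le_dual_norm:
  fixes p :: "'a::euclidean_space \<Rightarrow> real"
  assumes "is_norm p"
  shows "v \<bullet> x \<le> dual_norm p v * p x"
proof (cases "x = 0")
  case False
  then have px: "p x > 0" using is_norm_nonneg[OF assms, of x] is_norm_zero[OF assms, of x] by linarith
  then have "p ((1 / p x) *\<^sub>R x) = 1" by (simp add: is_norm_scale[OF assms])
  then have "v \<bullet> ((1 / p x) *\<^sub>R x) \<le> dual_norm p v"
    unfolding dual_norm_def by (intro cSUP_upper dual_norm_bdd_above[OF assms]) simp
  then show ?thesis using px by (simp add: field_simps)
qed (use is_norm_zero[OF assms, of 0] in simp)

lemma dual_norm_leI: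
  fixes p :: "'a::euclidean_space \<Rightarrow> real"
  assumes "is_norm p" "\<And>x. v \<bullet> x \<le> r * p x"
  shows "dual_norm p v \<le> r"
  unfolding dual_norm_def
  using assms(2) by (intro cSUP_least is_norm_sphere_nonempty assms) (metis mem_Collect_eq mult.right_neutral)

lemma dual_norm_nonneg:
  fixes p :: "'a::euclidean_space \<Rightarrow> real"
  assumes "is_norm p"
  shows "0 \<le> dual_norm p v"
proof -
  obtain x where x: "p x = 1" using is_norm_sphere_nonempty[OF assms] by blast
  have "v \<bullet> x \<le> dual_norm p v" "v \<bullet> (-x) \<le> dual_norm p v"
    using inner_le_dual_norm[OF assms, of v x] inner_le_dual_norm[OF assms, of v "-x"] x
    by (simp_all add: is_norm_minus[OF assms])
  then show ?thesis by simp
qed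

lemma dual_norm_scale_le:
  fixes p :: "'a::euclidean_space \<Rightarrow> real"
  assumes "is_norm p"
  shows "dual_norm p (c *\<^sub>R v) \<le> \<bar>c\<bar> * dual_norm p v"
proof (rule dual_norm_leI[OF assms])
  fix x
  have "v \<bullet> (c *\<^sub>R x) \<le> dual_norm p v * p (c *\<^sub>R x)" by (rule inner_le_dual_norm[OF assms])
  then show "(c *\<^sub>R v) \<bullet> x \<le> \<bar>c\<bar> * dual_norm p v * p x"
    by (simp add: is_norm_scale[OF assms] mult_ac)
qed

lemma is_norm_dual_norm:
  fixes p :: "'a::euclidean_space \<Rightarrow> real"
  assumes "is_norm p"
  shows "is_norm (dual_norm p)"
  unfolding is_norm_def
proof (intro conjI allI)
  fix v w :: 'a and c :: real
  show "dual_norm p v = 0 \<longleftrightarrow> v = 0"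
  proof
    assume "dual_norm p v = 0"
    then show "v = 0" using inner_le_dual_norm[OF assms, of v v] by (simp add: inner_gt_zero_iff flip: not_less)
  next
    assume "v = 0"
    then show "dual_norm p v = 0"
      using dual_norm_leI[OF assms, of v 0] dual_norm_nonneg[OF assms, of v] by simp
  qed
  show "dual_norm p (c *\<^sub>R v) = \<bar>c\<bar> * dual_norm p v"
  proof (rule antisym[OF dual_norm_scale_le[OF assms]])
    show "\<bar>c\<bar> * dual_norm p v \<le> dual_norm p (c *\<^sub>R v)"
    proof (cases "c = 0")
      case False
      then have "dual_norm p v \<le> \<bar>1 / c\<bar> * dual_norm p (c *\<^sub>R v)"
        using dual_norm_scale_le[OF assms, of "1 / c" "c *\<^sub>R v"] by simp
      then show ?thesis using False by (simp add: field_simps)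
    qed (simp add: dual_norm_nonneg[OF assms])
  qed
  show "dual_norm p (v + w) \<le> dual_norm p v + dual_norm p w"
  proof (rule dual_norm_leI[OF assms])
    fix x
    show "(v + w) \<bullet> x \<le> (dual_norm p v + dual_norm p w) * p x"
      using inner_le_dual_norm[OF assms, of v x] inner_le_dual_norm[OF assms, of w x]
      by (simp add: inner_add_left distrib_right)
  qed
qed

section \<open>Nemirovski's inequality in finite dimension\<close>

lemma integrable_norm_sq_of_norm:
  fixes q :: "'a::euclidean_space \<Rightarrow> real"
  assumes q: "is_norm q" and X: "X \<in> borel_measurable P" and i: "integrable P (\<lambda>\<omega>. (q (X \<omega>))\<^sup>2)"
  shows "integrable P (\<lambda>\<omega>. (norm (X \<omega>))\<^sup>2)"
proof -
  obtain e where e: "e > 0" "\<And>x. e * norm x \<le> q x" using is_norm_lower[OF q] by blast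
  have le: "(norm y)\<^sup>2 \<le> (1 / e\<^sup>2) * (q y)\<^sup>2" for y
  proof -
    have "(e * norm y)\<^sup>2 \<le> (q y)\<^sup>2" using e(1) by (intro power_mono e) simp
    then show ?thesis using e(1) by (simp add: field_simps)
  qed
  show ?thesis
    by (rule Bochner_Integration.integrable_bound[where f="\<lambda>\<omega>. (1 / e\<^sup>2) * (q (X \<omega>))\<^sup>2"])
      (use i X le in auto)
qed

lemma (in prob_space) expectation_norm_sq_sum_indep:
  fixes X :: "nat \<Rightarrow> 'a \<Rightarrow> 'b::euclidean_space"
  assumes ind: "indep_vars (\<lambda>_. borel) X {..<n}"
    and zero: "\<And>i. i < n \<Longrightarrow> has_bochner_integral M (X i) 0"
    and sq: "\<And>i. i < n \<Longrightarrow> integrable M (\<lambda>\<omega>. (norm (X i \<omega>))\<^sup>2)"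
  shows "has_bochner_integral M (\<lambda>\<omega>. (norm (\<Sum>i<n. X i \<omega>))\<^sup>2) (\<Sum>i<n. \<integral>\<omega>. (norm (X i \<omega>))\<^sup>2 \<partial>M)"
proof -
  have pair: "has_bochner_integral M (\<lambda>\<omega>. X i \<omega> \<bullet> X j \<omega>)
      (if i = j then \<integral>\<omega>. (norm (X i \<omega>))\<^sup>2 \<partial>M else 0)" if "i < n" "j < n" for i j
  proof (cases "i = j")
    case True
    then show ?thesis using sq[OF that(1)]
      by (simp add: has_bochner_integral_iff power2_norm_eq_inner)
  next
    case False
    \<comment> \<open>The product rule for independent variables is a statement about scalars, so
      each coordinate is treated separately.\<close>
    have c: "has_bochner_integral M (\<lambda>\<omega>. (X i \<omega> \<bullet> b) * (X j \<omega> \<bullet> b)) 0" for b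
    proof -
      have z: "has_bochner_integral M (\<lambda>\<omega>. X k \<omega> \<bullet> b) 0" if "k < n" for k
        using has_bochner_integral_inner_left[OF zero[OF that], of b] by simp
      have "indep_vars (\<lambda>_. borel) X {i, j}" by (rule indep_vars_subset[OF ind]) (use that in auto)
      then have iv: "indep_vars (\<lambda>_. borel) (\<lambda>k \<omega>. X k \<omega> \<bullet> b) {i, j}"
        by (rule indep_vars_compose2) auto
      have ii: "integrable M (\<lambda>\<omega>. X k \<omega> \<bullet> b)" "integral\<^sup>L M (\<lambda>\<omega>. X k \<omega> \<bullet> b) = 0" if "k \<in> {i, j}" for k
        using z that \<open>i < n\<close> \<open>j < n\<close> by (auto simp: has_bochner_integral_iff)
      show ?thesis
        using indep_vars_integrable[OF _ iv ii(1)] indep_vars_lebesgue_integral[OF _ iv ii(1)] ii(2) False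
        by (simp add: has_bochner_integral_iff)
    qed
    have "has_bochner_integral M (\<lambda>\<omega>. \<Sum>b\<in>Basis. (X i \<omega> \<bullet> b) * (X j \<omega> \<bullet> b)) (\<Sum>b\<in>(Basis::'b set). 0)"
      by (rule has_bochner_integral_sum) (rule c)
    then show ?thesis using False by (simp flip: euclidean_inner)
  qed
  have "has_bochner_integral M (\<lambda>\<omega>. \<Sum>i<n. \<Sum>j<n. X i \<omega> \<bullet> X j \<omega>)
      (\<Sum>i<n. \<Sum>j<n. if i = j then \<integral>\<omega>. (norm (X i \<omega>))\<^sup>2 \<partial>M else 0)"
    by (intro has_bochner_integral_sum pair) auto
  also have "(\<lambda>\<omega>. \<Sum>i<n. \<Sum>j<n. X i \<omega> \<bullet> X j \<omega>) = (\<lambda>\<omega>. (norm (\<Sum>i<n. X i \<omega>))\<^sup>2)"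
    unfolding power2_norm_eq_inner inner_sum_left inner_sum_right by (rule ext, subst sum.swap) (rule refl)
  also have "(\<Sum>i<n. \<Sum>j<n. if i = j then \<integral>\<omega>. (norm (X i \<omega>))\<^sup>2 \<partial>M else 0) =
      (\<Sum>i<n. \<integral>\<omega>. (norm (X i \<omega>))\<^sup>2 \<partial>M)" by simp
  finally show ?thesis .
qed

text \<open>In coordinates, independent zero-mean vectors are orthogonal for the Euclidean norm, and all
  norms are equivalent; hence the set whose infimum is the Nemirovski constant is not empty.\<close>

lemma nemirovski_bound_exists:
  fixes q :: "'a::euclidean_space \<Rightarrow> real"
  assumes q: "is_norm q"
  shows "\<exists>\<kappa>. nemirovski_bound q \<kappa>"
proof -
  define C where "C = (\<Sum>b\<in>Basis. q (b :: 'a))"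
  have upper: "q y \<le> C * norm y" for y unfolding C_def by (rule is_norm_upper[OF q])
  obtain e where e: "e > 0" "\<And>x. e * norm x \<le> q x" using is_norm_lower[OF q] by blast
  have le1: "(q y)\<^sup>2 \<le> C\<^sup>2 * (norm y)\<^sup>2" for y
    using power_mono[OF upper is_norm_nonneg[OF q], of y 2] by (simp add: power_mult_distrib)
  have le2: "(norm y)\<^sup>2 \<le> (1 / e\<^sup>2) * (q y)\<^sup>2" for y
  proof -
    have "(e * norm y)\<^sup>2 \<le> (q y)\<^sup>2" using e(1) by (intro power_mono e) simp
    then show ?thesis using e(1) by (simp add: field_simps)
  qed
  have "nemirovski_bound q (C\<^sup>2 / e\<^sup>2)"
    unfolding nemirovski_bound_def
  proof (intro conjI allI impI)
    fix P :: "(nat \<Rightarrow> 'a) measure" and X :: "nat \<Rightarrow> (nat \<Rightarrow> 'a) \<Rightarrow> 'a" and n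
    assume "prob_space P" and ind: "prob_space.indep_vars P (\<lambda>_. borel) X {..<n}"
      and X: "\<forall>i<n. has_bochner_integral P (X i) 0 \<and> integrable P (\<lambda>\<omega>. (q (X i \<omega>))\<^sup>2)"
    interpret prob_space P by fact
    have sq: "integrable P (\<lambda>\<omega>. (norm (X i \<omega>))\<^sup>2)" if "i < n" for i
      using X that by (intro integrable_norm_sq_of_norm[OF q]) (auto simp: has_bochner_integral_iff)
    have h: "has_bochner_integral P (\<lambda>\<omega>. (norm (\<Sum>i<n. X i \<omega>))\<^sup>2) (\<Sum>i<n. \<integral>\<omega>. (norm (X i \<omega>))\<^sup>2 \<partial>P)"
      by (rule expectation_norm_sq_sum_indep[OF ind]) (use X sq in auto)
    have "(\<integral>\<omega>. (q (\<Sum>i<n. X i \<omega>))\<^sup>2 \<partial>P) \<le> (\<integral>\<omega>. C\<^sup>2 * (norm (\<Sum>i<n. X i \<omega>))\<^sup>2 \<partial>P)"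
      using h le1 by (intro integral_mono_AE') (auto simp: has_bochner_integral_iff)
    also have "\<dots> = C\<^sup>2 * (\<Sum>i<n. \<integral>\<omega>. (norm (X i \<omega>))\<^sup>2 \<partial>P)"
      using h by (simp add: has_bochner_integral_iff)
    also have "\<dots> \<le> C\<^sup>2 * (\<Sum>i<n. \<integral>\<omega>. (1 / e\<^sup>2) * (q (X i \<omega>))\<^sup>2 \<partial>P)"
      using X sq le2 by (intro mult_left_mono sum_mono integral_mono) auto
    also have "\<dots> = C\<^sup>2 / e\<^sup>2 * (\<Sum>i<n. \<integral>\<omega>. (q (X i \<omega>))\<^sup>2 \<partial>P)"
      by (simp flip: sum_divide_distrib)
    finally show "(\<integral>\<omega>. (q (\<Sum>i<n. X i \<omega>))\<^sup>2 \<partial>P) \<le> C\<^sup>2 / e\<^sup>2 * (\<Sum>i<n. \<integral>\<omega>. (q (X i \<omega>))\<^sup>2 \<partial>P)" .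
  qed simp
  then show ?thesis ..
qed

text \<open>Nothing is known about \<open>Inf\<close> of an empty set of reals, so the existence of
  some bound has to come first; each admissible bound is nonnegative by definition.\<close>

lemma nemirovski_const_nonneg:
  fixes q :: "'a::euclidean_space \<Rightarrow> real"
  assumes "is_norm q"
  shows "0 \<le> nemirovski_const q"
  unfolding nemirovski_const_def
  using nemirovski_bound_exists[OF assms]
  by (intro cInf_greatest) (blast, simp add: nemirovski_bound_def)

section \<open>Mirror descent\<close>

text \<open>The limit \<open>t \<rightarrow> 0\<close> by hand: if \<open>a\<close> were negative, a
  \<open>t\<close> with \<open>t * b \<le> - a / 2\<close> would refute the hypothesis. Used to drop
  second-order terms of a variation along a segment.\<close>

lemma nonneg_of_affine_nonneg:
  fixes a b :: real
  assumes "\<And>t. 0 < t \<Longrightarrow> t < 1 \<Longrightarrow> 0 \<le> a + t * b"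
  shows "0 \<le> a"
proof (rule ccontr)
  assume "\<not> 0 \<le> a"
  then have a: "a < 0" by simp
  define t where "t = min (1/2) (- a / (2 * (\<bar>b\<bar> + 1)))"
  have t: "0 < t" "t < 1" using a unfolding t_def by (auto simp: divide_neg_pos)
  have "t * b \<le> t * (\<bar>b\<bar> + 1)" using t by (intro mult_left_mono) auto
  also have "\<dots> \<le> (- a / (2 * (\<bar>b\<bar> + 1))) * (\<bar>b\<bar> + 1)"
    unfolding t_def by (intro mult_right_mono) auto
  also have "\<dots> = - a / 2" by (simp add: field_simps)
  finally show False using assms[OF t] a by linarith
qed

locale prox_setup =
  fixes p :: "'a::euclidean_space \<Rightarrow> real" and Q :: "'a set" and d :: "'a \<Rightarrow> real" and gd :: "'a \<Rightarrow> 'a"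
  assumes norm: "is_norm p" and conv: "convex Q" and comp: "compact Q" and nonempty: "Q \<noteq> {}"
    and prox: "prox_function p Q d gd"
begin

lemma cont_d: "continuous_on Q d"
  and strong_d: "x \<in> Q \<Longrightarrow> y \<in> Q \<Longrightarrow> 0 \<le> u \<Longrightarrow> 0 \<le> v \<Longrightarrow> u + v = 1 \<Longrightarrow>
     d (u *\<^sub>R x + v *\<^sub>R y) \<le> u * d x + v * d y - u * v * (p (x - y))\<^sup>2 / 2"
  and subgradient_gd: "x \<in> subdiff_domain Q d \<Longrightarrow> y \<in> Q \<Longrightarrow> d y \<ge> d x + gd x \<bullet> (y - x)"
  and cont_gd: "continuous_on (subdiff_domain Q d) gd"
  using prox unfolding prox_function_def strongly_convex_wrt_def is_subgradient_def by auto

lemma subdiff_domainD: "x \<in> subdiff_domain Q d \<Longrightarrow> x \<in> Q"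
  unfolding subdiff_domain_def by simp

text \<open>Up to a constant, a mirror step from \<open>x\<close> along \<open>v\<close> minimizes
  this function for \<open>w = v - gd x\<close>, and the prox center is the case
  \<open>w = 0\<close>. Minimality, optimality and continuity are thus proved once for both.\<close>

definition prox_min :: "'a \<Rightarrow> 'a" where
  "prox_min w = arg_min_on (\<lambda>y. w \<bullet> y + d y) Q"

lemma prox_min_minimizes:
  "prox_min w \<in> Q" "y \<in> Q \<Longrightarrow> w \<bullet> prox_min w + d (prox_min w) \<le> w \<bullet> y + d y"
proof -
  have "\<exists>x\<in>Q. \<forall>y\<in>Q. w \<bullet> x + d x \<le> w \<bullet> y + d y"
    by (rule continuous_attains_inf[OF comp nonempty]) (intro continuous_intros cont_d)
  then have "\<exists>x. is_arg_min (\<lambda>y. w \<bullet> y + d y) (\<lambda>y. y \<in> Q) x"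
    by (auto simp: is_arg_min_linorder)
  then have "is_arg_min (\<lambda>y. w \<bullet> y + d y) (\<lambda>y. y \<in> Q) (prox_min w)"
    unfolding prox_min_def arg_min_on_def arg_min_def by (rule someI_ex)
  then show "prox_min w \<in> Q" "y \<in> Q \<Longrightarrow> w \<bullet> prox_min w + d (prox_min w) \<le> w \<bullet> y + d y"
    by (auto simp: is_arg_min_linorder)
qed

text \<open>Minimality is compared with strong convexity at
  \<open>u *\<^sub>R z + (1 - u) *\<^sub>R y\<close>; after cancelling the factor
  \<open>1 - u\<close>, letting \<open>u\<close> tend to 1 gives the full constant 1/2.\<close>

lemma minimizer_growth:
  assumes z: "z \<in> Q" "\<And>y. y \<in> Q \<Longrightarrow> w \<bullet> z + d z \<le> w \<bullet> y + d y" and y: "y \<in> Q"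
  shows "(p (y - z))\<^sup>2 / 2 \<le> (w \<bullet> y + d y) - (w \<bullet> z + d z)"
proof (rule field_le_mult_one_interval)
  fix u :: real assume u: "0 < u" "u < 1"
  let ?x = "u *\<^sub>R z + (1 - u) *\<^sub>R y"
  have "?x \<in> Q" using conv z(1) y u by (intro convexD) auto
  then have "w \<bullet> z + d z \<le> w \<bullet> ?x + d ?x" by (rule z(2))
  also have "d ?x \<le> u * d z + (1 - u) * d y - u * (1 - u) * (p (z - y))\<^sup>2 / 2"
    using u by (intro strong_d z(1) y) auto
  finally have "(1 - u) * (u * ((p (y - z))\<^sup>2 / 2)) \<le> (1 - u) * ((w \<bullet> y + d y) - (w \<bullet> z + d z))"
    using is_norm_minus_commute[OF norm, of z y] by (simp add: algebra_simps inner_add_right)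
  then show "u * ((p (y - z))\<^sup>2 / 2) \<le> (w \<bullet> y + d y) - (w \<bullet> z + d z)"
    using u by (simp add: mult_le_cancel_left_pos)
qed

text \<open>The vector \<open>- w\<close> is a subgradient at \<open>z\<close>. Hence every mirror
  step lands where \<open>gd\<close> is constrained to be a subgradient.\<close>

lemma minimizer_subdiff_domain:
  assumes z: "z \<in> Q" "\<And>y. y \<in> Q \<Longrightarrow> w \<bullet> z + d z \<le> w \<bullet> y + d y"
  shows "z \<in> subdiff_domain Q d"
proof -
  have "is_subgradient Q d z (- w)"
    using z(2) unfolding is_subgradient_def by (force simp: inner_diff_right)
  then show ?thesis using z(1) unfolding subdiff_domain_def by blast
qed

text \<open>The points with a subgradient are dense: such a point is the Euclidean proximal point of any
  given point of \<open>Q\<close>.\<close>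

lemma proximal_point:
  assumes a: "a \<in> Q" and s: "s > 0"
  obtains u where "u \<in> subdiff_domain Q d" "(norm (u - a))\<^sup>2 \<le> 2 * s * (d a - d u)"
proof -
  obtain u where u: "u \<in> Q"
    and min: "\<And>y. y \<in> Q \<Longrightarrow> d u + (u - a) \<bullet> (u - a) / (2 * s) \<le> d y + (y - a) \<bullet> (y - a) / (2 * s)"
  proof -
    have "\<exists>u\<in>Q. \<forall>y\<in>Q. d u + (u - a) \<bullet> (u - a) / (2 * s) \<le> d y + (y - a) \<bullet> (y - a) / (2 * s)"
      by (rule continuous_attains_inf[OF comp nonempty]) (use s in \<open>intro continuous_intros cont_d; simp\<close>)
    then show ?thesis using that by blast
  qed
  have "is_subgradient Q d u (- (1 / s) *\<^sub>R (u - a))"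
    unfolding is_subgradient_def
  proof
    fix q assume q: "q \<in> Q"
    \<comment> \<open>Variation of the penalized objective along the segment from \<open>u\<close>
      to \<open>q\<close>: convexity controls \<open>d\<close>, and the quadratic penalty leaves a
      remainder of order \<open>t * t\<close>, negligible after division by
      \<open>t\<close>.\<close>
    have "0 \<le> (d q - d u + (u - a) \<bullet> (q - u) / s)"
    proof (rule nonneg_of_affine_nonneg)
      fix t :: real assume t: "0 < t" "t < 1"
      let ?x = "(1 - t) *\<^sub>R u + t *\<^sub>R q"
      have xQ: "?x \<in> Q" using conv u q t by (intro convexD) auto
      have "d ?x \<le> (1 - t) * d u + t * d q - (1 - t) * t * (p (u - q))\<^sup>2 / 2"
        using t by (intro strong_d u q) auto
      also have "\<dots> \<le> (1 - t) * d u + t * d q" using t by simp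
      finally have 1: "d ?x \<le> (1 - t) * d u + t * d q" .
      have eq: "?x - a = (u - a) + t *\<^sub>R (q - u)" by (simp add: algebra_simps)
      have 2: "(?x - a) \<bullet> (?x - a) = (u - a) \<bullet> (u - a) + 2 * t * ((u - a) \<bullet> (q - u)) + t * t * ((q - u) \<bullet> (q - u))"
        unfolding eq by (simp add: inner_add_left inner_add_right inner_commute algebra_simps)
      have "0 \<le> t * (d q - d u + (u - a) \<bullet> (q - u) / s + t * ((q - u) \<bullet> (q - u) / (2 * s)))"
      proof -
        have "((u - a) \<bullet> (u - a) + 2 * t * ((u - a) \<bullet> (q - u)) + t * t * ((q - u) \<bullet> (q - u))) / (2 * s) =
            (u - a) \<bullet> (u - a) / (2 * s) + t * ((u - a) \<bullet> (q - u) / s) + t * (t * ((q - u) \<bullet> (q - u) / (2 * s)))"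
          using s by (simp add: field_simps)
        then show ?thesis using min[OF xQ] 1 unfolding 2 by (simp add: algebra_simps)
      qed
      then show "0 \<le> d q - d u + (u - a) \<bullet> (q - u) / s + t * ((q - u) \<bullet> (q - u) / (2 * s))"
        using t by (simp add: zero_le_mult_iff)
    qed
    then show "d u + (- (1 / s) *\<^sub>R (u - a)) \<bullet> (q - u) \<le> d q" by simp
  qed
  then have "u \<in> subdiff_domain Q d" using u unfolding subdiff_domain_def by blast
  moreover have "(norm (u - a))\<^sup>2 \<le> 2 * s * (d a - d u)"
    using min[OF a] s by (simp add: power2_norm_eq_inner field_simps)
  ultimately show ?thesis by (rule that)
qed

text \<open>The optimality condition holds for the selected subgradient \<open>gd z\<close>, not merely for some
  subgradient: approach \<open>z\<close> from the direction of \<open>y\<close> through points with a subgradient and use the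
  continuity of the selection.\<close>

lemma minimizer_first_order:
  assumes z: "z \<in> Q" "\<And>y. y \<in> Q \<Longrightarrow> w \<bullet> z + d z \<le> w \<bullet> y + d y" and y: "y \<in> Q"
  shows "0 \<le> (gd z + w) \<bullet> (y - z)"
proof -
  obtain B where B: "\<And>q. q \<in> Q \<Longrightarrow> \<bar>d q\<bar> \<le> B"
    using compact_imp_bounded[OF compact_continuous_image[OF cont_d comp]]
    unfolding bounded_iff by auto
  have B0: "0 \<le> B" using B[OF y] by linarith
  define t where "t n = 1 / real (Suc n)" for n
  have t: "0 < t n" "t n \<le> 1" for n unfolding t_def by auto
  have t0: "t \<longlonglongrightarrow> 0" unfolding t_def by (rule LIMSEQ_Suc[OF lim_1_over_n])
  define a where "a n = z + t n *\<^sub>R (y - z)" for n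
  have aQ: "a n \<in> Q" for n
  proof -
    have "(1 - t n) *\<^sub>R z + t n *\<^sub>R y \<in> Q" using conv z(1) y t[of n] by (intro convexD) auto
    then show ?thesis unfolding a_def by (simp add: algebra_simps)
  qed
  \<comment> \<open>The proximal parameter \<open>(t n)^4\<close> keeps \<open>u n\<close> within
    order \<open>(t n)\<^sup>2\<close> of the segment point \<open>a n\<close>. This is negligible
    against \<open>t n\<close>, so \<open>u n\<close> approaches \<open>z\<close> in the direction
    \<open>y - z\<close>.\<close>
  have "\<exists>u. u \<in> subdiff_domain Q d \<and> norm (u - a n) \<le> 2 * sqrt B * (t n)\<^sup>2" for n
  proof -
    obtain u where u: "u \<in> subdiff_domain Q d" "(norm (u - a n))\<^sup>2 \<le> 2 * (t n)^4 * (d (a n) - d u)"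
      using proximal_point[OF aQ[of n] zero_less_power[OF t(1), of n 4]] by blast
    have "d (a n) - d u \<le> 2 * B" using B[OF aQ[of n]] B[OF subdiff_domainD[OF u(1)]] by linarith
    then have "(norm (u - a n))\<^sup>2 \<le> 2 * (t n)^4 * (2 * B)"
      using u(2) t[of n] by (smt (verit) mult_left_mono zero_le_power)
    also have "\<dots> = (2 * sqrt B * (t n)\<^sup>2)\<^sup>2"
      using B0 by (simp add: power_mult_distrib)
    finally have "norm (u - a n) \<le> 2 * sqrt B * (t n)\<^sup>2"
      by (rule power2_le_imp_le) (use B0 in simp)
    with u(1) show ?thesis by blast
  qed
  then obtain u where u: "\<And>n. u n \<in> subdiff_domain Q d" "\<And>n. norm (u n - a n) \<le> 2 * sqrt B * (t n)\<^sup>2"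
    by metis
  have l1: "(\<lambda>n. (u n - a n) /\<^sub>R t n) \<longlonglongrightarrow> 0"
  proof (rule Lim_null_comparison)
    show "\<forall>\<^sub>F n in sequentially. norm ((u n - a n) /\<^sub>R t n) \<le> 2 * sqrt B * t n"
    proof (intro always_eventually allI)
      fix n
      have "norm ((u n - a n) /\<^sub>R t n) = norm (u n - a n) / t n" using t[of n] by (simp add: divide_inverse mult.commute)
      also have "\<dots> \<le> 2 * sqrt B * t n" using u(2)[of n] t[of n] by (simp add: divide_le_eq power2_eq_square mult_ac)
      finally show "norm ((u n - a n) /\<^sub>R t n) \<le> 2 * sqrt B * t n" .
    qed
    show "(\<lambda>n. 2 * sqrt B * t n) \<longlonglongrightarrow> 0" using tendsto_mult_right_zero[OF t0] by simp
  qed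
  have e: "(u n - z) /\<^sub>R t n = (y - z) + (u n - a n) /\<^sub>R t n" for n
    using t[of n] unfolding a_def by (simp add: algebra_simps)
  have l2: "(\<lambda>n. (u n - z) /\<^sub>R t n) \<longlonglongrightarrow> y - z"
    unfolding e using tendsto_add[OF tendsto_const l1, of "y - z"] by simp
  have "(\<lambda>n. z + t n *\<^sub>R ((u n - z) /\<^sub>R t n)) \<longlonglongrightarrow> z + 0 *\<^sub>R (y - z)"
    by (intro tendsto_intros t0 l2)
  moreover have "z + t n *\<^sub>R ((u n - z) /\<^sub>R t n) = u n" for n using t[of n] by simp
  ultimately have l3: "u \<longlonglongrightarrow> z" by simp
  have "(\<lambda>n. gd (u n)) \<longlonglongrightarrow> gd z"
    using cont_gd minimizer_subdiff_domain[OF z] l3 u(1) by (auto simp: continuous_on_sequentially comp_def)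
  then have "(\<lambda>n. (gd (u n) + w) \<bullet> ((u n - z) /\<^sub>R t n)) \<longlonglongrightarrow> (gd z + w) \<bullet> (y - z)"
    by (intro tendsto_intros l2)
  moreover have "0 \<le> (gd (u n) + w) \<bullet> ((u n - z) /\<^sub>R t n)" for n
  proof -
    have "d z \<ge> d (u n) + gd (u n) \<bullet> (z - u n)" by (rule subgradient_gd[OF u(1) z(1)])
    moreover have "w \<bullet> z + d z \<le> w \<bullet> u n + d (u n)" by (rule z(2)[OF subdiff_domainD[OF u(1)]])
    ultimately have "0 \<le> (gd (u n) + w) \<bullet> (u n - z)" by (simp add: inner_add_left inner_diff_right)
    then show ?thesis using t[of n] by simp
  qed
  ultimately show ?thesis by (meson LIMSEQ_le_const)
qed

lemma prox_min_subdiff_domain: "prox_min w \<in> subdiff_domain Q d"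
  using prox_min_minimizes by (rule minimizer_subdiff_domain)

text \<open>Adding the growth inequalities at the two minimizers cancels \<open>d\<close> and yields
  a Lipschitz bound. The continuity later makes the iterates measurable.\<close>

lemma continuous_prox_min: "continuous_on UNIV prox_min"
proof -
  obtain e where e: "e > 0" "\<And>x. e * norm x \<le> p x" using is_norm_lower[OF norm] by blast
  have "(1 / e\<^sup>2)-lipschitz_on UNIV prox_min"
  proof (rule lipschitz_onI)
    fix v w :: 'a
    let ?x = "prox_min v" and ?y = "prox_min w"
    have "(p (?y - ?x))\<^sup>2 / 2 \<le> (v \<bullet> ?y + d ?y) - (v \<bullet> ?x + d ?x)"
      using prox_min_minimizes by (intro minimizer_growth)
    moreover have "(p (?x - ?y))\<^sup>2 / 2 \<le> (w \<bullet> ?x + d ?x) - (w \<bullet> ?y + d ?y)"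
      using prox_min_minimizes by (intro minimizer_growth)
    ultimately have "(p (?x - ?y))\<^sup>2 \<le> (v - w) \<bullet> (?y - ?x)"
      using is_norm_minus_commute[OF norm, of ?x ?y] by (simp add: inner_diff_left inner_diff_right)
    also have "\<dots> \<le> norm (v - w) * norm (?y - ?x)" by (rule norm_cauchy_schwarz)
    finally have "(p (?x - ?y))\<^sup>2 \<le> norm (v - w) * norm (?x - ?y)" by (simp add: norm_minus_commute)
    moreover have "(e * norm (?x - ?y))\<^sup>2 \<le> (p (?x - ?y))\<^sup>2" using e by (intro power_mono) auto
    ultimately have "(e\<^sup>2 * norm (?x - ?y)) * norm (?x - ?y) \<le> norm (v - w) * norm (?x - ?y)"
      by (simp add: power2_eq_square mult_ac)
    then have "e\<^sup>2 * norm (?x - ?y) \<le> norm (v - w)"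
      by (cases "?x = ?y") (auto dest: mult_right_le_imp_le)
    then show "dist ?x ?y \<le> 1 / e\<^sup>2 * dist v w" using e(1) by (simp add: dist_norm field_simps)
  qed simp
  then show ?thesis by (rule lipschitz_on_continuous_on)
qed

lemma mirr_eq: "mirr Q d gd x v = prox_min (v - gd x)"
proof -
  have "is_arg_min (\<lambda>y. v \<bullet> y + bregman d gd x y) (\<lambda>y. y \<in> Q) =
      is_arg_min (\<lambda>y. (v - gd x) \<bullet> y + d y) (\<lambda>y. y \<in> Q)"
    unfolding is_arg_min_linorder bregman_def by (rule ext) (simp add: algebra_simps inner_diff_left inner_diff_right)
  then show ?thesis unfolding mirr_def prox_min_def arg_min_on_def arg_min_def by simp
qed

lemma prox_center_eq: "prox_center Q d = prox_min 0"
  unfolding prox_center_def prox_min_def by simp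

lemma mirr_subdiff_domain: "mirr Q d gd x v \<in> subdiff_domain Q d"
  unfolding mirr_eq by (rule prox_min_subdiff_domain)

lemma prox_center_subdiff_domain: "prox_center Q d \<in> subdiff_domain Q d"
  unfolding prox_center_eq by (rule prox_min_subdiff_domain)

text \<open>The subgradient inequality says that \<open>x\<close> minimizes \<open>d\<close> tilted
  by \<open>- gd x\<close>, so quadratic growth applies with \<open>w = - gd x\<close>.\<close>

lemma bregman_ge:
  assumes x: "x \<in> subdiff_domain Q d" and y: "y \<in> Q"
  shows "(p (x - y))\<^sup>2 / 2 \<le> bregman d gd x y"
proof -
  have "(- gd x) \<bullet> x + d x \<le> (- gd x) \<bullet> q + d q" if "q \<in> Q" for q
    using subgradient_gd[OF x that] by (simp add: inner_diff_right)
  from minimizer_growth[OF subdiff_domainD[OF x] this y] show ?thesis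
    using is_norm_minus_commute[OF norm, of x y] unfolding bregman_def by (simp add: inner_diff_right)
qed

text \<open>The right-hand side equals \<open>(gd x' - gd x) \<bullet> (y - x')\<close> exactly, so
  this is the first-order condition at \<open>x'\<close> rewritten.\<close>

lemma mirr_three_points:
  fixes x v :: 'a
  assumes y: "y \<in> Q"
  defines "x' \<equiv> mirr Q d gd x v"
  shows "v \<bullet> (x' - y) \<le> bregman d gd x y - bregman d gd x' y - bregman d gd x x'"
proof -
  have "0 \<le> (gd x' + (v - gd x)) \<bullet> (y - x')"
    unfolding x'_def mirr_eq using prox_min_minimizes y by (intro minimizer_first_order)
  then show ?thesis unfolding bregman_def by (simp add: inner_diff_left inner_diff_right inner_add_left)
qed

text \<open>The part \<open>v \<bullet> (x - x')\<close> is split by Young's inequality; its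
  quadratic term is absorbed by the Bregman distance from \<open>x\<close> to \<open>x'\<close> that
  the three-point inequality leaves over.\<close>

lemma mirr_descent:
  assumes x: "x \<in> subdiff_domain Q d" and y: "y \<in> Q" and v: "dual_norm p v \<le> G"
  shows "v \<bullet> (x - y) \<le> bregman d gd x y - bregman d gd (mirr Q d gd x v) y + G\<^sup>2 / 2"
proof -
  let ?x' = "mirr Q d gd x v"
  have "v \<bullet> (x - ?x') \<le> dual_norm p v * p (x - ?x')" by (rule inner_le_dual_norm[OF norm])
  also have "\<dots> \<le> G * p (x - ?x')" by (intro mult_right_mono v is_norm_nonneg norm)
  also have "\<dots> \<le> G\<^sup>2 / 2 + (p (x - ?x'))\<^sup>2 / 2"
    using zero_le_power2[of "G - p (x - ?x')"] by (simp add: power2_eq_square algebra_simps)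
  also have "\<dots> \<le> G\<^sup>2 / 2 + bregman d gd x ?x'"
    using bregman_ge[OF x subdiff_domainD[OF mirr_subdiff_domain]] by simp
  finally show ?thesis using mirr_three_points[OF y, of v x] by (simp add: inner_diff_right)
qed

section \<open>Diameter and regret bounds in terms of \<open>Theta_sq\<close>\<close>

lemma le_Theta_sq: "y \<in> Q \<Longrightarrow> d y - d (prox_center Q d) \<le> Theta_sq Q d"
  unfolding Theta_sq_def
  by (intro cSUP_upper compact_imp_bounded[THEN bounded_imp_bdd_above]
      compact_continuous_image comp continuous_intros cont_d)

lemma norm_sq_diff_prox_center_le:
  assumes "y \<in> Q"
  shows "(p (y - prox_center Q d))\<^sup>2 \<le> 2 * Theta_sq Q d"
  using minimizer_growth[OF prox_min_minimizes(1,2) assms, of 0] le_Theta_sq[OF assms]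
  unfolding prox_center_eq by simp

lemma Theta_sq_nonneg: "0 \<le> Theta_sq Q d"
proof -
  obtain y where "y \<in> Q" using nonempty by blast
  from norm_sq_diff_prox_center_le[OF this] zero_le_power2[of "p (y - prox_center Q d)"]
  show ?thesis by linarith
qed

text \<open>Both points are within \<open>sqrt (2 * Theta_sq Q d)\<close> of the prox center, by
  quadratic growth at the minimizer of \<open>d\<close>.\<close>

lemma norm_diff_le_Theta:
  assumes "x \<in> Q" "y \<in> Q"
  shows "p (x - y) \<le> sqrt (8 * Theta_sq Q d)"
proof -
  let ?o = "prox_center Q d"
  have "p (x - y) \<le> p (x - ?o) + p (y - ?o)"
    using is_norm_triangle[OF norm, of "x - ?o" "?o - y"] is_norm_minus_commute[OF norm, of y ?o] by simp
  also have "\<dots> \<le> sqrt (2 * Theta_sq Q d) + sqrt (2 * Theta_sq Q d)"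
    using assms by (intro add_mono real_le_rsqrt norm_sq_diff_prox_center_le)
  also have "\<dots> = sqrt (2\<^sup>2 * (2 * Theta_sq Q d))" by (simp only: real_sqrt_mult real_sqrt_abs)
  finally show ?thesis by simp
qed

lemma mirror_descent_subdiff_domain:
  assumes "X 0 = prox_center Q d" "\<And>k. k < N \<Longrightarrow> X (Suc k) = mirr Q d gd (X k) (w k)" "k \<le> N"
  shows "X k \<in> subdiff_domain Q d"
  using assms by (cases k) (auto simp: prox_center_subdiff_domain mirr_subdiff_domain)

lemma mirror_descent_regret:
  assumes X0: "X 0 = prox_center Q d" and X: "\<And>k. k < N \<Longrightarrow> X (Suc k) = mirr Q d gd (X k) (w k)"
    and w: "\<And>k. k < N \<Longrightarrow> dual_norm p (w k) \<le> G" and y: "y \<in> Q"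
  shows "(\<Sum>k<N. w k \<bullet> (X k - y)) \<le> Theta_sq Q d + real N * G\<^sup>2 / 2"
proof -
  have dom: "X k \<in> subdiff_domain Q d" if "k \<le> N" for k
    by (rule mirror_descent_subdiff_domain[OF X0 X that])
  have "(\<Sum>k<N. w k \<bullet> (X k - y)) \<le> (\<Sum>k<N. (bregman d gd (X k) y - bregman d gd (X (Suc k)) y) + G\<^sup>2 / 2)"
    using mirr_descent[OF dom y w] X by (intro sum_mono) auto
  also have "\<dots> = bregman d gd (X 0) y - bregman d gd (X N) y + real N * G\<^sup>2 / 2"
    unfolding sum.distrib sum_lessThan_telescope'[of "\<lambda>k. bregman d gd (X k) y" N] by simp
  finally have "(\<Sum>k<N. w k \<bullet> (X k - y)) \<le> bregman d gd (X 0) y - bregman d gd (X N) y + real N * G\<^sup>2 / 2" .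
  moreover have "0 \<le> bregman d gd (X N) y"
    using bregman_ge[OF dom y, of N] zero_le_power2[of "p (X N - y)"] by linarith
  \<comment> \<open>First-order optimality of the prox center for \<open>d\<close> makes
    \<open>gd (X 0) \<bullet> (y - X 0)\<close> nonnegative.\<close>
  moreover have "bregman d gd (X 0) y \<le> d y - d (prox_center Q d)"
    using minimizer_first_order[OF prox_min_minimizes(1,2) y, of 0]
    unfolding bregman_def X0 prox_center_eq by simp
  ultimately show ?thesis using le_Theta_sq[OF y] by linarith
qed

end

section \<open>Fresh samples\<close>

text \<open>Independence of the past as a product law: the past is represented by the identity map
  into the coarser sigma-algebra, so everything \<open>F\<close>-measurable becomes a function of
  the first coordinate. Rectangles determine the law.\<close>

lemma (in prob_space) distr_pair_indep_subalgebra: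
  assumes F: "subalgebra M F" and xi: "xi \<in> measurable M S" and law: "distr M S xi = S"
    and ind: "indep_set (sets F) (sets (vimage_algebra (space M) xi S))"
  shows "distr M (F \<Otimes>\<^sub>M S) (\<lambda>\<omega>. (\<omega>, xi \<omega>)) = distr M F (\<lambda>\<omega>. \<omega>) \<Otimes>\<^sub>M S"
proof -
  have sp: "space F = space M" using F by (simp add: subalgebra_def)
  have id: "(\<lambda>\<omega>. \<omega>) \<in> measurable M F" using measurable_from_subalg[OF F measurable_ident_sets[OF refl]] by simp
  have pair: "(\<lambda>\<omega>. (\<omega>, xi \<omega>)) \<in> measurable M (F \<Otimes>\<^sub>M S)" using id xi by simp
  have "distr M F (\<lambda>\<omega>. \<omega>) \<Otimes>\<^sub>M S = distr M (F \<Otimes>\<^sub>M S) (\<lambda>\<omega>. (\<omega>, xi \<omega>))"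
  proof (rule pair_measure_eqI)
    show "sigma_finite_measure (distr M F (\<lambda>\<omega>. \<omega>))" "sigma_finite_measure S"
      using prob_space_distr[OF id] prob_space_distr[OF xi] law
      by (simp_all add: prob_space_imp_sigma_finite)
    show "sets (distr M F (\<lambda>\<omega>. \<omega>) \<Otimes>\<^sub>M S) = sets (distr M (F \<Otimes>\<^sub>M S) (\<lambda>\<omega>. (\<omega>, xi \<omega>)))"
      by (simp cong: sets_pair_measure_cong)
    fix A B assume A: "A \<in> sets (distr M F (\<lambda>\<omega>. \<omega>))" and B: "B \<in> sets S"
    let ?B = "xi -` B \<inter> space M"
    have A': "A \<in> sets F" "A \<subseteq> space M" using A sets.sets_into_space[of A F] sp by auto
    have "?B \<in> sets (vimage_algebra (space M) xi S)" using B by (rule in_vimage_algebra)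
    then have "prob (A \<inter> ?B) = prob A * prob ?B" using indep_setD[OF ind A'(1)] by simp
    moreover have "emeasure (distr M (F \<Otimes>\<^sub>M S) (\<lambda>\<omega>. (\<omega>, xi \<omega>))) (A \<times> B) = emeasure M (A \<inter> ?B)"
      using A' B by (subst emeasure_distr[OF pair]) (auto intro!: arg_cong[where f="emeasure M"])
    moreover have "emeasure S B = emeasure M ?B"
      using emeasure_distr[OF xi B] law by simp
    moreover have "emeasure (distr M F (\<lambda>\<omega>. \<omega>)) A = emeasure M A"
      using A' by (simp add: emeasure_distr[OF id] Int_absorb2)
    ultimately show "emeasure (distr M F (\<lambda>\<omega>. \<omega>)) A * emeasure S B =
        emeasure (distr M (F \<Otimes>\<^sub>M S) (\<lambda>\<omega>. (\<omega>, xi \<omega>))) (A \<times> B)"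
      by (simp add: emeasure_eq_measure ennreal_mult'')
  qed
  then show ?thesis ..
qed

text \<open>Freezing the past: by the product law and Tonelli, the fresh sample may be integrated
  first with \<open>\<omega>\<close> held fixed.\<close>

lemma (in prob_space) nn_integral_indep_subalgebra:
  assumes F: "subalgebra M F" and xi: "xi \<in> measurable M S" and law: "distr M S xi = S"
    and ind: "indep_set (sets F) (sets (vimage_algebra (space M) xi S))"
    and h: "h \<in> borel_measurable (F \<Otimes>\<^sub>M S)"
  shows "(\<integral>\<^sup>+\<omega>. h (\<omega>, xi \<omega>) \<partial>M) = (\<integral>\<^sup>+\<omega>. \<integral>\<^sup>+s. h (\<omega>, s) \<partial>S \<partial>M)"
proof -
  interpret S: prob_space S using prob_space_distr[OF xi] law by simp
  have id: "(\<lambda>\<omega>. \<omega>) \<in> measurable M F" using measurable_from_subalg[OF F measurable_ident_sets[OF refl]] by simp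
  have pair: "(\<lambda>\<omega>. (\<omega>, xi \<omega>)) \<in> measurable M (F \<Otimes>\<^sub>M S)" using id xi by simp
  have h': "h \<in> borel_measurable (distr M F (\<lambda>\<omega>. \<omega>) \<Otimes>\<^sub>M S)"
    using h by (simp cong: measurable_cong_sets sets_pair_measure_cong)
  have "(\<integral>\<^sup>+\<omega>. h (\<omega>, xi \<omega>) \<partial>M) = integral\<^sup>N (distr M F (\<lambda>\<omega>. \<omega>) \<Otimes>\<^sub>M S) h"
    unfolding distr_pair_indep_subalgebra[OF F xi law ind, symmetric]
    using h by (simp add: nn_integral_distr[OF pair])
  also have "\<dots> = (\<integral>\<^sup>+\<omega>. \<integral>\<^sup>+s. h (\<omega>, s) \<partial>S \<partial>distr M F (\<lambda>\<omega>. \<omega>))"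
    by (rule S.nn_integral_fst[OF h', symmetric])
  also have "\<dots> = (\<integral>\<^sup>+\<omega>. \<integral>\<^sup>+s. h (\<omega>, s) \<partial>S \<partial>M)"
    by (rule nn_integral_distr[OF id]) (use S.borel_measurable_nn_integral_fst[OF h] in simp)
  finally show ?thesis .
qed

lemma (in prob_space) AE_indep_subalgebra:
  assumes F: "subalgebra M F" and xi: "xi \<in> measurable M S" and law: "distr M S xi = S"
    and ind: "indep_set (sets F) (sets (vimage_algebra (space M) xi S))"
    and R: "Measurable.pred (F \<Otimes>\<^sub>M S) R" and AE: "\<And>\<omega>. \<omega> \<in> space M \<Longrightarrow> AE s in S. R (\<omega>, s)"
  shows "AE \<omega> in M. R (\<omega>, xi \<omega>)"
proof -
  have id: "(\<lambda>\<omega>. \<omega>) \<in> measurable M F" using measurable_from_subalg[OF F measurable_ident_sets[OF refl]] by simp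
  have pair: "(\<lambda>\<omega>. (\<omega>, xi \<omega>)) \<in> measurable M (F \<Otimes>\<^sub>M S)" using id xi by simp
  define h :: "'a \<times> 'b \<Rightarrow> ennreal" where "h q = indicator {q. \<not> R q} q" for q
  have h: "h \<in> borel_measurable (F \<Otimes>\<^sub>M S)"
    unfolding h_def using R by (intro borel_measurable_indicator') (auto simp: pred_def)
  have "(\<integral>\<^sup>+\<omega>. h (\<omega>, xi \<omega>) \<partial>M) = (\<integral>\<^sup>+\<omega>. \<integral>\<^sup>+s. h (\<omega>, s) \<partial>S \<partial>M)"
    by (rule nn_integral_indep_subalgebra[OF F xi law ind h])
  also have "\<dots> = (\<integral>\<^sup>+\<omega>. 0 \<partial>M)"
  proof (rule nn_integral_cong)
    fix \<omega> assume w: "\<omega> \<in> space M"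
    have "(\<integral>\<^sup>+s. h (\<omega>, s) \<partial>S) = (\<integral>\<^sup>+s. 0 \<partial>S)"
      by (rule nn_integral_cong_AE) (use AE[OF w] in \<open>auto simp: h_def elim!: eventually_mono\<close>)
    then show "(\<integral>\<^sup>+s. h (\<omega>, s) \<partial>S) = 0" by simp
  qed
  finally have "(\<integral>\<^sup>+\<omega>. h (\<omega>, xi \<omega>) \<partial>M) = 0" by simp
  moreover have "(\<lambda>\<omega>. h (\<omega>, xi \<omega>)) \<in> borel_measurable M" using measurable_compose[OF pair h] by simp
  ultimately have "AE \<omega> in M. h (\<omega>, xi \<omega>) = 0" by (simp add: nn_integral_0_iff_AE)
  then show ?thesis by eventually_elim (auto simp: h_def split: split_indicator_asm)
qed

locale stochastic_gradient = S: prob_space S for S :: "'s measure" +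
  fixes p :: "'a::euclidean_space \<Rightarrow> real" and Q :: "'a set" and G :: "'a \<Rightarrow> 's \<Rightarrow> 'a" and grad :: "'a \<Rightarrow> 'a"
    and L :: real
  assumes norm: "is_norm p"
    and meas: "(\<lambda>(y, s). G y s) \<in> borel_measurable (restrict_space borel Q \<Otimes>\<^sub>M S)"
    and unbiased: "\<And>y. y \<in> Q \<Longrightarrow> has_bochner_integral S (G y) (grad y)"
    and bounded: "\<And>y. y \<in> Q \<Longrightarrow> AE s in S. dual_norm p (G y s) \<le> L"
    and L: "0 < L"
begin

lemma inner_unbiased: "y \<in> Q \<Longrightarrow> has_bochner_integral S (\<lambda>s. G y s \<bullet> u) (grad y \<bullet> u)"
  using has_bochner_integral_inner_left[of u S "G y" "grad y"] unbiased by auto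

text \<open>Each linear functional \<open>u\<close> is integrated separately, which avoids any
  convexity argument for the dual norm. Together with the bound on \<open>G\<close> it limits the
  noise to \<open>2 * L\<close>.\<close>

lemma dual_norm_grad: "y \<in> Q \<Longrightarrow> dual_norm p (grad y) \<le> L"
proof (rule dual_norm_leI[OF norm])
  fix u assume y: "y \<in> Q"
  have "(\<integral>s. G y s \<bullet> u \<partial>S) \<le> (\<integral>s. L * p u \<partial>S)"
  proof (rule integral_mono_AE)
    show "AE s in S. G y s \<bullet> u \<le> L * p u"
      using bounded[OF y]
    proof eventually_elim
      case (elim s)
      have "G y s \<bullet> u \<le> dual_norm p (G y s) * p u" by (rule inner_le_dual_norm[OF norm])
      also have "\<dots> \<le> L * p u" by (intro mult_right_mono elim is_norm_nonneg norm)
      finally show ?case .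
    qed
  qed (use inner_unbiased[OF y, of u] in \<open>auto simp: has_bochner_integral_iff\<close>)
  then show "grad y \<bullet> u \<le> L * p u"
    using inner_unbiased[OF y, of u] by (simp add: has_bochner_integral_iff S.prob_space)
qed

text \<open>A selection of subgradients need not be measurable in itself; this one is a parametrized
  integral of the jointly measurable oracle.\<close>

lemma measurable_grad: "grad \<in> borel_measurable (restrict_space borel Q)"
proof -
  have "(\<lambda>y. \<integral>s. G y s \<partial>S) \<in> borel_measurable (restrict_space borel Q)"
    by (rule S.borel_measurable_lebesgue_integral) (rule meas)
  moreover have "(\<integral>s. G y s \<partial>S) = grad y" if "y \<in> Q" for y
    using unbiased[OF that] by (simp add: has_bochner_integral_iff)
  ultimately show ?thesis by (subst measurable_cong[where g="\<lambda>y. \<integral>s. G y s \<partial>S"]) (auto simp: space_restrict_space)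
qed

text \<open>Hoeffding's lemma on an interval of length \<open>2 * L * D\<close>, whose factor
  \<open>(2 * L * D)\<^sup>2 / 8\<close> is \<open>(L * D)\<^sup>2 / 2\<close>. The direction
  \<open>- u\<close> supplies the lower endpoint.\<close>

lemma nn_integral_exp_le:
  assumes y: "y \<in> Q" and u: "p u \<le> D" and r: "0 < r"
  shows "(\<integral>\<^sup>+s. ennreal (exp (r * ((G y s - grad y) \<bullet> u))) \<partial>S) \<le> ennreal (exp (r\<^sup>2 * (L * D)\<^sup>2 / 2))"
proof -
  define a where "a = - (L * D) - grad y \<bullet> u"
  define b where "b = L * D - grad y \<bullet> u"
  interpret interval_bounded_random_variable S "\<lambda>s. (G y s - grad y) \<bullet> u" a b
  proof
    have "G y \<in> borel_measurable S" using unbiased[OF y] by (rule borel_measurable_has_bochner_integral)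
    then show "(\<lambda>s. (G y s - grad y) \<bullet> u) \<in> borel_measurable S" by measurable
    show "AE s in S. (G y s - grad y) \<bullet> u \<in> {a..b}"
      using bounded[OF y]
    proof eventually_elim
      case (elim s)
      have bd: "G y s \<bullet> v \<le> L * D" if "p v \<le> D" for v
      proof -
        have "G y s \<bullet> v \<le> dual_norm p (G y s) * p v" by (rule inner_le_dual_norm[OF norm])
        also have "\<dots> \<le> L * p v" by (intro mult_right_mono elim is_norm_nonneg norm)
        also have "\<dots> \<le> L * D" using that L by simp
        finally show ?thesis .
      qed
      show ?case using bd[OF u] bd[of "- u"] u is_norm_minus[OF norm, of u]
        by (simp add: a_def b_def inner_diff_left)
    qed
  qed
  have "(\<integral>s. (G y s - grad y) \<bullet> u \<partial>S) = 0"
    using inner_unbiased[OF y, of u] by (simp add: inner_diff_left has_bochner_integral_iff S.prob_space)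
  from Hoeffdings_lemma_nn_integral_0[OF r this]
  show ?thesis by (simp add: a_def b_def power2_eq_square algebra_simps)
qed

context
  fixes P F xi X
  assumes P: "prob_space P" and F: "subalgebra P F" and xi: "xi \<in> measurable P S" and law: "distr P S xi = S"
    and ind: "prob_space.indep_set P (sets F) (sets (vimage_algebra (space P) xi S))"
    and X: "X \<in> measurable F (restrict_space borel Q)"
begin

lemma in_Q: "\<omega> \<in> space P \<Longrightarrow> X \<omega> \<in> Q"
  using measurable_space[OF X] F by (auto simp: space_restrict_space subalgebra_def)

lemma measurable_sample: "(\<lambda>(\<omega>, s). G (X \<omega>) s) \<in> borel_measurable (F \<Otimes>\<^sub>M S)"
proof -
  have "(\<lambda>q. (X (fst q), snd q)) \<in> measurable (F \<Otimes>\<^sub>M S) (restrict_space borel Q \<Otimes>\<^sub>M S)"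
    using X by measurable
  from measurable_compose[OF this meas] show ?thesis by (simp add: case_prod_beta')
qed

lemma measurable_grad_comp: "(\<lambda>\<omega>. grad (X \<omega>)) \<in> borel_measurable F"
  by (rule measurable_compose[OF X measurable_grad])

lemma AE_fresh_sample_bounded: "AE \<omega> in P. dual_norm p (G (X \<omega>) (xi \<omega>)) \<le> L"
proof -
  have [measurable]: "dual_norm p \<in> borel_measurable borel"
    by (intro borel_measurable_continuous_onI is_norm_continuous is_norm_dual_norm norm)
  note measurable_sample[measurable]
  have "AE \<omega> in P. case (\<omega>, xi \<omega>) of (\<omega>, s) \<Rightarrow> dual_norm p (G (X \<omega>) s) \<le> L"
    by (rule prob_space.AE_indep_subalgebra[OF P F xi law ind]) (measurable, use bounded in_Q in auto)
  then show ?thesis by simp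
qed

text \<open>A conditional moment bound in integrated form: freezing the past turns \<open>U\<close>
  and \<open>W\<close> into constants, and Hoeffding's lemma applies at each
  \<open>\<omega>\<close>.\<close>

lemma nn_integral_fresh_sample_exp_le:
  assumes U: "U \<in> borel_measurable F" "\<And>\<omega>. \<omega> \<in> space P \<Longrightarrow> p (U \<omega>) \<le> D"
    and W: "W \<in> borel_measurable F" and r: "0 < r"
  shows "(\<integral>\<^sup>+\<omega>. W \<omega> * ennreal (exp (r * ((G (X \<omega>) (xi \<omega>) - grad (X \<omega>)) \<bullet> U \<omega>))) \<partial>P)
    \<le> ennreal (exp (r\<^sup>2 * (L * D)\<^sup>2 / 2)) * (\<integral>\<^sup>+\<omega>. W \<omega> \<partial>P)"
proof -
  note [measurable] = measurable_sample measurable_grad_comp U(1) W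
  have [measurable]: "W \<in> borel_measurable P" by (rule measurable_from_subalg[OF F W])
  define h where "h = (\<lambda>(\<omega>, s). W \<omega> * ennreal (exp (r * ((G (X \<omega>) s - grad (X \<omega>)) \<bullet> U \<omega>))))"
  have h: "h \<in> borel_measurable (F \<Otimes>\<^sub>M S)" unfolding h_def by measurable
  have "(\<integral>\<^sup>+\<omega>. W \<omega> * ennreal (exp (r * ((G (X \<omega>) (xi \<omega>) - grad (X \<omega>)) \<bullet> U \<omega>))) \<partial>P) = (\<integral>\<^sup>+\<omega>. h (\<omega>, xi \<omega>) \<partial>P)"
    by (simp add: h_def)
  also have "\<dots> = (\<integral>\<^sup>+\<omega>. \<integral>\<^sup>+s. h (\<omega>, s) \<partial>S \<partial>P)"
    by (rule prob_space.nn_integral_indep_subalgebra[OF P F xi law ind h])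
  also have "\<dots> \<le> (\<integral>\<^sup>+\<omega>. ennreal (exp (r\<^sup>2 * (L * D)\<^sup>2 / 2)) * W \<omega> \<partial>P)"
  proof (rule nn_integral_mono)
    fix \<omega> assume w: "\<omega> \<in> space P"
    have [measurable]: "G (X \<omega>) \<in> borel_measurable S"
      using unbiased[OF in_Q[OF w]] by (rule borel_measurable_has_bochner_integral)
    have "(\<integral>\<^sup>+s. h (\<omega>, s) \<partial>S) = W \<omega> * (\<integral>\<^sup>+s. ennreal (exp (r * ((G (X \<omega>) s - grad (X \<omega>)) \<bullet> U \<omega>))) \<partial>S)"
      unfolding h_def by (simp add: nn_integral_cmult)
    also have "\<dots> \<le> W \<omega> * ennreal (exp (r\<^sup>2 * (L * D)\<^sup>2 / 2))"
      by (intro mult_left_mono nn_integral_exp_le in_Q w U r) simp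
    finally show "(\<integral>\<^sup>+s. h (\<omega>, s) \<partial>S) \<le> ennreal (exp (r\<^sup>2 * (L * D)\<^sup>2 / 2)) * W \<omega>" by (simp add: mult.commute)
  qed
  also have "\<dots> = ennreal (exp (r\<^sup>2 * (L * D)\<^sup>2 / 2)) * (\<integral>\<^sup>+\<omega>. W \<omega> \<partial>P)"
    by (rule nn_integral_cmult) measurable
  finally show ?thesis .
qed

end

end

section \<open>Mirror descent with stochastic subgradients\<close>

text \<open>What the analysis uses of one oracle at one step, with the sample space eliminated, so
  that the objective and all constraints can share an index. Quantifying over all weights
  \<open>W\<close> expresses a bound on the conditional exponential moment given \<open>F\<close>;
  the queries \<open>X\<close> and directions \<open>U\<close> are likewise known
  beforehand.\<close>

definition fresh_subgradient ::
  "('a::euclidean_space \<Rightarrow> real) \<Rightarrow> 'a set \<Rightarrow> real \<Rightarrow> 'w measure \<Rightarrow> 'w measure \<Rightarrow> 'w measure \<Rightarrow>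
   ('a \<Rightarrow> 'w \<Rightarrow> 'a) \<Rightarrow> ('a \<Rightarrow> 'a) \<Rightarrow> bool" where
  "fresh_subgradient p Q L P F F' V A \<longleftrightarrow>
     A \<in> borel_measurable (restrict_space borel Q) \<and> (\<forall>y\<in>Q. dual_norm p (A y) \<le> L) \<and>
     (\<forall>X\<in>measurable F (restrict_space borel Q).
        (\<lambda>\<omega>. V (X \<omega>) \<omega>) \<in> borel_measurable F' \<and>
        (AE \<omega> in P. dual_norm p (V (X \<omega>) \<omega>) \<le> L) \<and>
        (\<forall>U\<in>borel_measurable F. \<forall>W\<in>borel_measurable F. \<forall>D. \<forall>r>0. (\<forall>\<omega>\<in>space P. p (U \<omega>) \<le> D) \<longrightarrow>
           (\<integral>\<^sup>+\<omega>. W \<omega> * ennreal (exp (r * ((V (X \<omega>) \<omega> - A (X \<omega>)) \<bullet> U \<omega>))) \<partial>P)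
             \<le> ennreal (exp (r\<^sup>2 * (L * D)\<^sup>2 / 2)) * (\<integral>\<^sup>+\<omega>. W \<omega> \<partial>P)))"

lemma (in stochastic_gradient) fresh_subgradient:
  assumes P: "prob_space P" and F: "subalgebra P F" and F': "subalgebra P F'" "sets F \<subseteq> sets F'"
    and xi: "xi \<in> measurable F' S" and law: "distr P S xi = S"
    and ind: "prob_space.indep_set P (sets F) (sets (vimage_algebra (space P) xi S))"
  shows "fresh_subgradient p Q L P F F' (\<lambda>y \<omega>. G y (xi \<omega>)) grad"
  unfolding fresh_subgradient_def
proof (intro conjI ballI allI impI)
  have xiP: "xi \<in> measurable P S" by (rule measurable_from_subalg[OF F'(1) xi])
  have sub: "subalgebra F' F" using F F' by (auto simp: subalgebra_def)
  show "grad \<in> borel_measurable (restrict_space borel Q)" by (rule measurable_grad)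
  show "dual_norm p (grad y) \<le> L" if "y \<in> Q" for y using that by (rule dual_norm_grad)
  fix X assume X: "X \<in> measurable F (restrict_space borel Q)"
  have "(\<lambda>\<omega>. (X \<omega>, xi \<omega>)) \<in> measurable F' (restrict_space borel Q \<Otimes>\<^sub>M S)"
    using measurable_from_subalg[OF sub X] xi by (rule measurable_Pair)
  from measurable_compose[OF this meas] show "(\<lambda>\<omega>. G (X \<omega>) (xi \<omega>)) \<in> borel_measurable F'" by simp
  show "AE \<omega> in P. dual_norm p (G (X \<omega>) (xi \<omega>)) \<le> L"
    by (rule AE_fresh_sample_bounded[OF P F xiP law ind X])
  fix U D and W :: "'b \<Rightarrow> ennreal" and r :: real
  assume "U \<in> borel_measurable F" "W \<in> borel_measurable F" "0 < r" "\<forall>\<omega>\<in>space P. p (U \<omega>) \<le> D"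
  then show "(\<integral>\<^sup>+\<omega>. W \<omega> * ennreal (exp (r * ((G (X \<omega>) (xi \<omega>) - grad (X \<omega>)) \<bullet> U \<omega>))) \<partial>P)
      \<le> ennreal (exp (r\<^sup>2 * (L * D)\<^sup>2 / 2)) * (\<integral>\<^sup>+\<omega>. W \<omega> \<partial>P)"
    by (intro nn_integral_fresh_sample_exp_le[OF P F xiP law ind X]) auto
qed

text \<open>Chernoff's method for adapted increments: the last one is peeled off by taking as weight
  \<open>W\<close> the exponential of the preceding partial sum, and Markov's inequality
  concludes.\<close>

lemma (in prob_space) prob_sum_ge_le_of_exp_moments:
  fixes Y :: "nat \<Rightarrow> 'a \<Rightarrow> real"
  assumes F: "\<And>k. subalgebra M (F k)" and mono: "\<And>i j. i \<le> j \<Longrightarrow> sets (F i) \<subseteq> sets (F j)"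
    and Y: "\<And>k. k < N \<Longrightarrow> Y k \<in> borel_measurable (F (Suc k))"
    and exp: "\<And>k W. k < N \<Longrightarrow> W \<in> borel_measurable (F k) \<Longrightarrow>
      (\<integral>\<^sup>+\<omega>. W \<omega> * ennreal (exp (r * Y k \<omega>)) \<partial>M) \<le> ennreal (exp C) * (\<integral>\<^sup>+\<omega>. W \<omega> \<partial>M)"
    and r: "0 < r"
  shows "prob {\<omega> \<in> space M. t \<le> (\<Sum>k<N. Y k \<omega>)} \<le> exp (real N * C - r * t)"
proof -
  have Yn: "Y k \<in> borel_measurable (F n)" if "k < n" "n \<le> N" for k n
  proof -
    have "subalgebra (F n) (F (Suc k))" using F mono[of "Suc k" n] that by (auto simp: subalgebra_def)
    then show ?thesis by (rule measurable_from_subalg) (use Y that in auto)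
  qed
  have W: "(\<lambda>\<omega>. ennreal (exp (r * (\<Sum>k<n. Y k \<omega>)))) \<in> borel_measurable (F n)" if "n \<le> N" for n
    by (intro measurable_compose[OF _ measurable_ennreal] borel_measurable_exp[THEN measurable_compose[rotated]]
        borel_measurable_times borel_measurable_const borel_measurable_sum) (use Yn that in auto)
  have moment: "(\<integral>\<^sup>+\<omega>. ennreal (exp (r * (\<Sum>k<n. Y k \<omega>))) \<partial>M) \<le> ennreal (exp (real n * C))" if "n \<le> N" for n
    using that
  proof (induction n)
    case 0
    then show ?case by (simp add: emeasure_space_1)
  next
    case (Suc n)
    have "(\<integral>\<^sup>+\<omega>. ennreal (exp (r * (\<Sum>k<Suc n. Y k \<omega>))) \<partial>M) =
        (\<integral>\<^sup>+\<omega>. ennreal (exp (r * (\<Sum>k<n. Y k \<omega>))) * ennreal (exp (r * Y n \<omega>)) \<partial>M)"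
      by (simp add: distrib_left exp_add ennreal_mult)
    also have "\<dots> \<le> ennreal (exp C) * (\<integral>\<^sup>+\<omega>. ennreal (exp (r * (\<Sum>k<n. Y k \<omega>))) \<partial>M)"
      using Suc.prems by (intro exp W) auto
    also have "\<dots> \<le> ennreal (exp C) * ennreal (exp (real n * C))"
      using Suc by (intro mult_left_mono) auto
    also have "\<dots> = ennreal (exp (real (Suc n) * C))"
      by (simp add: distrib_right exp_add flip: ennreal_mult)
    finally show ?case .
  qed
  have [measurable]: "(\<lambda>\<omega>. ennreal (exp (r * (\<Sum>k<N. Y k \<omega>)))) \<in> borel_measurable M"
    by (rule measurable_from_subalg[OF F W]) simp
  have "{\<omega> \<in> space M. t \<le> (\<Sum>k<N. Y k \<omega>)} =
      {\<omega> \<in> space M. 1 \<le> ennreal (exp (- (r * t))) * ennreal (exp (r * (\<Sum>k<N. Y k \<omega>)))}"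
    using r by (auto simp: ennreal_mult[symmetric] exp_add[symmetric] one_le_exp_iff)
  then have "emeasure M {\<omega> \<in> space M. t \<le> (\<Sum>k<N. Y k \<omega>)} =
      emeasure M {\<omega> \<in> space M. 1 \<le> ennreal (exp (- (r * t))) * ennreal (exp (r * (\<Sum>k<N. Y k \<omega>)))}" by simp
  also have "\<dots> \<le> ennreal (exp (- (r * t))) * (\<integral>\<^sup>+\<omega>. ennreal (exp (r * (\<Sum>k<N. Y k \<omega>))) * indicator (space M) \<omega> \<partial>M)"
    using nn_integral_Markov_inequality[of "\<lambda>\<omega>. ennreal (exp (r * (\<Sum>k<N. Y k \<omega>)))" "space M" M "ennreal (exp (- (r * t)))"]
    by (simp add: Int_def conj_commute)
  also have "(\<integral>\<^sup>+\<omega>. ennreal (exp (r * (\<Sum>k<N. Y k \<omega>))) * indicator (space M) \<omega> \<partial>M) =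
      (\<integral>\<^sup>+\<omega>. ennreal (exp (r * (\<Sum>k<N. Y k \<omega>))) \<partial>M)"
    by (intro nn_integral_cong) simp
  also have "ennreal (exp (- (r * t))) * \<dots> \<le> ennreal (exp (- (r * t))) * ennreal (exp (real N * C))"
    by (intro mult_left_mono moment) auto
  also have "\<dots> = ennreal (exp (real N * C - r * t))"
    by (simp add: exp_diff exp_minus divide_inverse mult.commute flip: ennreal_mult)
  finally show ?thesis by (simp add: emeasure_eq_measure)
qed

text \<open>Continuity of \<open>gd\<close> is available only on \<open>subdiff_domain Q d\<close>,
  so \<open>X\<close> has to be viewed as a map into that subspace before composing.\<close>

lemma (in prox_setup) measurable_mirr:
  assumes X: "X \<in> borel_measurable E" "\<And>\<omega>. \<omega> \<in> space E \<Longrightarrow> X \<omega> \<in> subdiff_domain Q d"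
    and v: "v \<in> borel_measurable E"
  shows "(\<lambda>\<omega>. mirr Q d gd (X \<omega>) (v \<omega>)) \<in> borel_measurable E"
proof -
  have "X \<in> measurable E (restrict_space borel (subdiff_domain Q d))"
    using X by (intro measurable_restrict_space2) auto
  from measurable_compose[OF this borel_measurable_continuous_on_restrict[OF cont_gd]]
  have "(\<lambda>\<omega>. v \<omega> - gd (X \<omega>)) \<in> borel_measurable E" using v by simp
  from measurable_compose[OF this borel_measurable_continuous_onI[OF continuous_prox_min]]
  show ?thesis by (simp add: mirr_eq)
qed

text \<open>The index \<open>b k\<close> names the oracle called at step \<open>k\<close>. It is
  computed from \<open>x k\<close>, so its measurability is assumed only conditionally on that of
  \<open>x k\<close>; the induction over \<open>k\<close> then resolves the mutual
  dependence.\<close>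

locale mirror_descent_process = prox_setup p Q d gd + P: prob_space P
  for p :: "'a::euclidean_space \<Rightarrow> real" and Q d gd and P :: "'w measure" +
  fixes F :: "nat \<Rightarrow> 'w measure" and N m :: nat and L \<eta> :: real
    and V :: "nat \<Rightarrow> nat \<Rightarrow> 'a \<Rightarrow> 'w \<Rightarrow> 'a" and A :: "nat \<Rightarrow> 'a \<Rightarrow> 'a"
    and b :: "nat \<Rightarrow> 'w \<Rightarrow> nat" and x :: "nat \<Rightarrow> 'w \<Rightarrow> 'a"
  assumes sub: "\<And>k. subalgebra P (F k)" and mono: "\<And>i j. i \<le> j \<Longrightarrow> sets (F i) \<subseteq> sets (F j)"
    and L: "0 < L" and eta: "0 < \<eta>"
    and fresh: "\<And>k l. k < N \<Longrightarrow> l \<le> m \<Longrightarrow> fresh_subgradient p Q L P (F k) (F (Suc k)) (V l k) (A l)"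
    and index: "\<And>k. k < N \<Longrightarrow> x k \<in> measurable (F k) (restrict_space borel Q) \<Longrightarrow>
      b k \<in> measurable (F k) (count_space {..m})"
    and x_0: "\<And>\<omega>. \<omega> \<in> space P \<Longrightarrow> x 0 \<omega> = prox_center Q d"
    and x_Suc: "\<And>k \<omega>. k < N \<Longrightarrow> \<omega> \<in> space P \<Longrightarrow>
      x (Suc k) \<omega> = mirr Q d gd (x k \<omega>) (\<eta> *\<^sub>R V (b k \<omega>) k (x k \<omega>) \<omega>)"
begin

definition sample :: "nat \<Rightarrow> 'w \<Rightarrow> 'a" where
  "sample k \<omega> = V (b k \<omega>) k (x k \<omega>) \<omega>"

definition noise :: "nat \<Rightarrow> 'w \<Rightarrow> 'a" where
  "noise k \<omega> = sample k \<omega> - A (b k \<omega>) (x k \<omega>)"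

text \<open>An auxiliary mirror descent that is driven by the noise alone. Its regret bounds the supremum over
  \<open>y\<close> of the noise term \<open>\<Sum>k. noise k \<bullet> (y - x k)\<close> by a scalar martingale plus a deterministic error,
  so that no Nemirovski-type inequality for martingales is needed.\<close>

primrec aux :: "real \<Rightarrow> nat \<Rightarrow> 'w \<Rightarrow> 'a" where
  "aux \<gamma> 0 \<omega> = prox_center Q d"
| "aux \<gamma> (Suc k) \<omega> = mirr Q d gd (aux \<gamma> k \<omega>) (- \<gamma> *\<^sub>R noise k \<omega>)"

section \<open>Adaptedness of the iterates and of the noise\<close>

lemma space_F: "space (F k) = space P"
  using sub by (simp add: subalgebra_def)

lemma measurable_F_mono: "f \<in> measurable (F i) K \<Longrightarrow> i \<le> j \<Longrightarrow> f \<in> measurable (F j) K"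
  using measurable_from_subalg[of "F j" "F i"] mono[of i j] by (auto simp: subalgebra_def space_F)

lemma x_subdiff_domain: "\<omega> \<in> space P \<Longrightarrow> k \<le> N \<Longrightarrow> x k \<omega> \<in> subdiff_domain Q d"
  using mirror_descent_subdiff_domain[of "\<lambda>k. x k \<omega>" N "\<lambda>k. \<eta> *\<^sub>R V (b k \<omega>) k (x k \<omega>) \<omega>" k] x_0 x_Suc by auto

lemma aux_subdiff_domain: "aux \<gamma> k \<omega> \<in> subdiff_domain Q d"
  by (cases k) (auto simp: prox_center_subdiff_domain mirr_subdiff_domain)

lemma x_in_Q: "\<omega> \<in> space P \<Longrightarrow> k \<le> N \<Longrightarrow> x k \<omega> \<in> Q"
  using x_subdiff_domain subdiff_domainD by blast

lemma aux_in_Q: "aux \<gamma> k \<omega> \<in> Q"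
  using aux_subdiff_domain subdiff_domainD by blast

lemma index_le: "k < N \<Longrightarrow> x k \<in> measurable (F k) (restrict_space borel Q) \<Longrightarrow> \<omega> \<in> space P \<Longrightarrow> b k \<omega> \<le> m"
  using measurable_space[OF index, of k \<omega>] by (simp add: space_F)

text \<open>The random index takes finitely many values, so oracles with a fixed index suffice.
  Measurability of \<open>x k\<close> is a premise because this is used inside the induction that
  proves it.\<close>

lemma measurable_sample_of_x:
  assumes k: "k < N" and x: "x k \<in> measurable (F k) (restrict_space borel Q)"
  shows "sample k \<in> borel_measurable (F (Suc k))"
  unfolding sample_def
proof (rule measurable_compose_countable'[where I="{..m}" and g="b k" and f="\<lambda>l \<omega>. V l k (x k \<omega>) \<omega>"])
  show "b k \<in> measurable (F (Suc k)) (count_space {..m})"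
    by (rule measurable_F_mono[OF index[OF k x]]) simp
  show "(\<lambda>\<omega>. V l k (x k \<omega>) \<omega>) \<in> borel_measurable (F (Suc k))" if "l \<in> {..m}" for l
    using fresh[OF k, of l] x that unfolding fresh_subgradient_def by auto
qed simp

lemma measurable_x: "k \<le> N \<Longrightarrow> x k \<in> measurable (F k) (restrict_space borel Q)"
proof (induction k)
  case 0
  have "x 0 \<in> borel_measurable (F 0)"
    by (subst measurable_cong[where g="\<lambda>_. prox_center Q d"]) (auto simp: space_F x_0)
  then show ?case by (intro measurable_restrict_space2) (auto simp: space_F x_in_Q)
next
  case (Suc k)
  then have k: "k < N" and x: "x k \<in> measurable (F k) (restrict_space borel Q)" by auto
  have "x k \<in> borel_measurable (F (Suc k))"
    using measurable_restrict_space2_iff[THEN iffD1, OF x] by (auto intro: measurable_F_mono)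
  then have "(\<lambda>\<omega>. mirr Q d gd (x k \<omega>) (\<eta> *\<^sub>R sample k \<omega>)) \<in> borel_measurable (F (Suc k))"
    using measurable_sample_of_x[OF k x] k by (intro measurable_mirr) (auto simp: space_F x_subdiff_domain)
  moreover have "x (Suc k) \<omega> = mirr Q d gd (x k \<omega>) (\<eta> *\<^sub>R sample k \<omega>)" if "\<omega> \<in> space (F (Suc k))" for \<omega>
    using x_Suc[OF k] that by (simp add: space_F sample_def)
  ultimately have "x (Suc k) \<in> borel_measurable (F (Suc k))"
    by (subst measurable_cong) auto
  then show ?case using Suc.prems by (intro measurable_restrict_space2) (auto simp: space_F x_in_Q)
qed

lemma measurable_x_borel: "k \<le> N \<Longrightarrow> x k \<in> borel_measurable (F k)"
  using measurable_x by (auto simp: measurable_restrict_space2_iff)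

lemma measurable_index: "k < N \<Longrightarrow> b k \<in> measurable (F k) (count_space {..m})"
  by (intro index measurable_x) auto

lemma b_le: "k < N \<Longrightarrow> \<omega> \<in> space P \<Longrightarrow> b k \<omega> \<le> m"
  by (rule index_le) (auto intro: measurable_x)

lemma measurable_noise:
  assumes "k < N"
  shows "noise k \<in> borel_measurable (F (Suc k))"
proof -
  have x: "x k \<in> measurable (F k) (restrict_space borel Q)" using assms by (intro measurable_x) simp
  have "(\<lambda>\<omega>. A (b k \<omega>) (x k \<omega>)) \<in> borel_measurable (F k)"
  proof (rule measurable_compose_countable'[where I="{..m}" and g="b k" and f="\<lambda>l \<omega>. A l (x k \<omega>)"])
    show "(\<lambda>\<omega>. A l (x k \<omega>)) \<in> borel_measurable (F k)" if "l \<in> {..m}" for l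
      using fresh[OF assms, of l] that measurable_compose[OF x] unfolding fresh_subgradient_def by auto
  qed (use measurable_index[OF assms] in auto)
  then have "(\<lambda>\<omega>. A (b k \<omega>) (x k \<omega>)) \<in> borel_measurable (F (Suc k))" by (rule measurable_F_mono) simp
  then show ?thesis unfolding noise_def using measurable_sample_of_x[OF assms x] by simp
qed

lemma measurable_aux: "k \<le> N \<Longrightarrow> aux \<gamma> k \<in> borel_measurable (F k)"
proof (induction k)
  case 0
  have "aux \<gamma> 0 = (\<lambda>_. prox_center Q d)" by (rule ext) simp
  then show ?case by simp
next
  case (Suc k)
  then have "aux \<gamma> k \<in> borel_measurable (F (Suc k))" by (auto intro: measurable_F_mono)
  then show ?case using measurable_noise[of k] Suc.prems
    by (auto intro!: measurable_mirr simp: aux_subdiff_domain)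
qed

lemma AE_bounded: "AE \<omega> in P. \<forall>k<N. dual_norm p (sample k \<omega>) \<le> L \<and> dual_norm p (noise k \<omega>) \<le> 2 * L"
proof -
  \<comment> \<open>All indices are handled at once, since the index actually used varies with
    \<open>\<omega>\<close>.\<close>
  have "AE \<omega> in P. \<forall>k\<in>{..<N}. \<forall>l\<in>{..m}. dual_norm p (V l k (x k \<omega>) \<omega>) \<le> L"
    using fresh measurable_x unfolding fresh_subgradient_def by (intro AE_finite_allI) (auto simp: less_imp_le)
  moreover have "AE \<omega> in P. \<omega> \<in> space P" by simp
  ultimately show ?thesis
  proof eventually_elim
    case (elim \<omega>)
    have "dual_norm p (sample k \<omega>) \<le> L \<and> dual_norm p (noise k \<omega>) \<le> 2 * L" if k: "k < N" for k
    proof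
      show s: "dual_norm p (sample k \<omega>) \<le> L" using elim k b_le unfolding sample_def by auto
      have "dual_norm p (A (b k \<omega>) (x k \<omega>)) \<le> L"
        using fresh[OF k b_le[OF k elim(2)]] x_in_Q[OF elim(2)] k unfolding fresh_subgradient_def by auto
      moreover have "dual_norm p (noise k \<omega>) \<le> dual_norm p (sample k \<omega>) + dual_norm p (A (b k \<omega>) (x k \<omega>))"
        unfolding noise_def
        using is_norm_triangle[OF is_norm_dual_norm[OF norm], of "sample k \<omega>" "- A (b k \<omega>) (x k \<omega>)"]
          is_norm_minus[OF is_norm_dual_norm[OF norm]] by simp
      ultimately show "dual_norm p (noise k \<omega>) \<le> 2 * L" using s by simp
    qed
    then show ?case by blast
  qed
qed

lemma regret_le:
  assumes w: "\<omega> \<in> space P" and y: "y \<in> Q" and g: "0 < \<gamma>"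
    and bd: "\<And>k. k < N \<Longrightarrow> dual_norm p (sample k \<omega>) \<le> L" "\<And>k. k < N \<Longrightarrow> dual_norm p (noise k \<omega>) \<le> 2 * L"
  shows "(\<Sum>k<N. A (b k \<omega>) (x k \<omega>) \<bullet> (x k \<omega> - y)) \<le>
    Theta_sq Q d / \<eta> + real N * \<eta> * L\<^sup>2 / 2 + Theta_sq Q d / \<gamma> + 2 * real N * \<gamma> * L\<^sup>2
    + (\<Sum>k<N. noise k \<omega> \<bullet> (aux \<gamma> k \<omega> - x k \<omega>))"
proof -
  note scale = is_norm_scale[OF is_norm_dual_norm[OF norm]]
  have "(\<Sum>k<N. (\<eta> *\<^sub>R sample k \<omega>) \<bullet> (x k \<omega> - y)) \<le> Theta_sq Q d + real N * (\<eta> * L)\<^sup>2 / 2"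
    using x_0[OF w] x_Suc[OF _ w] bd eta
    by (intro mirror_descent_regret y) (auto simp: sample_def scale)
  then have "\<eta> * (\<Sum>k<N. sample k \<omega> \<bullet> (x k \<omega> - y)) \<le> \<eta> * (Theta_sq Q d / \<eta> + real N * \<eta> * L\<^sup>2 / 2)"
    using eta by (simp add: sum_distrib_left distrib_left power2_eq_square mult_ac)
  then have 1: "(\<Sum>k<N. sample k \<omega> \<bullet> (x k \<omega> - y)) \<le> Theta_sq Q d / \<eta> + real N * \<eta> * L\<^sup>2 / 2"
    using eta by (rule mult_left_le_imp_le)
  \<comment> \<open>The step vectors of the auxiliary descent have dual norm at most
    \<open>\<gamma> * (2 * L)\<close>; the minus sign bounds the noise sum from the side that is
    needed.\<close>
  have "(\<Sum>k<N. (- \<gamma> *\<^sub>R noise k \<omega>) \<bullet> (aux \<gamma> k \<omega> - y)) \<le> Theta_sq Q d + real N * (\<gamma> * (2 * L))\<^sup>2 / 2"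
    using bd g is_norm_minus[OF is_norm_dual_norm[OF norm]]
    by (intro mirror_descent_regret y) (auto simp: scale)
  then have "\<gamma> * (- (\<Sum>k<N. noise k \<omega> \<bullet> (aux \<gamma> k \<omega> - y))) \<le> \<gamma> * (Theta_sq Q d / \<gamma> + 2 * real N * \<gamma> * L\<^sup>2)"
    using g by (simp add: sum_distrib_left sum_negf distrib_left power2_eq_square mult_ac)
  then have 2: "- (\<Sum>k<N. noise k \<omega> \<bullet> (aux \<gamma> k \<omega> - y)) \<le> Theta_sq Q d / \<gamma> + 2 * real N * \<gamma> * L\<^sup>2"
    using g by (rule mult_left_le_imp_le)
  have "(\<Sum>k<N. A (b k \<omega>) (x k \<omega>) \<bullet> (x k \<omega> - y)) =
      (\<Sum>k<N. sample k \<omega> \<bullet> (x k \<omega> - y)) - (\<Sum>k<N. noise k \<omega> \<bullet> (aux \<gamma> k \<omega> - y))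
      + (\<Sum>k<N. noise k \<omega> \<bullet> (aux \<gamma> k \<omega> - x k \<omega>))"
    unfolding sum_subtractf[symmetric] sum.distrib[symmetric]
    by (rule sum.cong) (auto simp: noise_def inner_diff_left inner_diff_right)
  with 1 2 show ?thesis by linarith
qed

text \<open>Restricting the weight to the event \<open>b k \<omega> = l\<close> reduces the random
  index to fixed ones, and summing over \<open>l\<close> restores \<open>W\<close>. The direction
  \<open>aux \<gamma> k \<omega> - x k \<omega>\<close> belongs to the past, as the moment bound
  requires.\<close>

lemma nn_integral_exp_noise_le:
  assumes k: "k < N" and W: "W \<in> borel_measurable (F k)" and r: "0 < r"
  shows "(\<integral>\<^sup>+\<omega>. W \<omega> * ennreal (exp (r * (noise k \<omega> \<bullet> (aux \<gamma> k \<omega> - x k \<omega>)))) \<partial>P)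
    \<le> ennreal (exp (4 * r\<^sup>2 * L\<^sup>2 * Theta_sq Q d)) * (\<integral>\<^sup>+\<omega>. W \<omega> \<partial>P)"
proof -
  define U where "U \<omega> = aux \<gamma> k \<omega> - x k \<omega>" for \<omega>
  define C where "C = ennreal (exp (4 * r\<^sup>2 * L\<^sup>2 * Theta_sq Q d))"
  define W' where "W' l \<omega> = W \<omega> * indicator {l} (b k \<omega>)" for l \<omega>
  define E where "E l \<omega> = W' l \<omega> * ennreal (exp (r * ((V l k (x k \<omega>) \<omega> - A l (x k \<omega>)) \<bullet> U \<omega>)))" for l \<omega>
  have x: "x k \<in> measurable (F k) (restrict_space borel Q)" using k by (intro measurable_x) simp
  have U: "U \<in> borel_measurable (F k)"
    unfolding U_def using k by (intro borel_measurable_diff measurable_aux measurable_x_borel) auto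
  have Ule: "p (U \<omega>) \<le> sqrt (8 * Theta_sq Q d)" if "\<omega> \<in> space P" for \<omega>
    unfolding U_def using k that by (intro norm_diff_le_Theta aux_in_Q x_in_Q) auto
  \<comment> \<open>With diameter bound \<open>D = sqrt (8 * Theta_sq Q d)\<close>, the exponent
    \<open>r\<^sup>2 * (L * D)\<^sup>2 / 2\<close> has the factor 8 / 2 = 4.\<close>
  have C: "C = ennreal (exp (r\<^sup>2 * (L * sqrt (8 * Theta_sq Q d))\<^sup>2 / 2))"
    using Theta_sq_nonneg by (simp add: C_def power_mult_distrib mult_ac)
  have W': "W' l \<in> borel_measurable (F k)" if "l \<le> m" for l
    unfolding W'_def
    using measurable_compose[OF measurable_index[OF k], of "indicator {l} :: nat \<Rightarrow> ennreal" borel] W by simp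
  have fresh_l: "E l \<in> borel_measurable P" "(\<integral>\<^sup>+\<omega>. E l \<omega> \<partial>P) \<le> C * (\<integral>\<^sup>+\<omega>. W' l \<omega> \<partial>P)" if l: "l \<le> m" for l
  proof -
    note o = fresh[OF k l, unfolded fresh_subgradient_def]
    have "(\<lambda>\<omega>. V l k (x k \<omega>) \<omega>) \<in> borel_measurable P"
      using o x by (intro measurable_from_subalg[OF sub]) auto
    moreover have "(\<lambda>\<omega>. A l (x k \<omega>)) \<in> borel_measurable P"
      using o measurable_compose[OF x] by (intro measurable_from_subalg[OF sub]) auto
    moreover have "U \<in> borel_measurable P" "W' l \<in> borel_measurable P"
      using measurable_from_subalg[OF sub] U W'[OF l] by auto
    ultimately show "E l \<in> borel_measurable P" unfolding E_def by measurable
    show "(\<integral>\<^sup>+\<omega>. E l \<omega> \<partial>P) \<le> C * (\<integral>\<^sup>+\<omega>. W' l \<omega> \<partial>P)"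
      unfolding E_def C using o x U W'[OF l] Ule r by blast
  qed
  have split: "(\<Sum>l\<le>m. W' l \<omega>) = W \<omega>" if "\<omega> \<in> space P" for \<omega>
    using b_le[OF k that] unfolding W'_def by (simp add: sum_distrib_left[symmetric] indicator_def)
  have "(\<integral>\<^sup>+\<omega>. W \<omega> * ennreal (exp (r * (noise k \<omega> \<bullet> U \<omega>))) \<partial>P) = (\<integral>\<^sup>+\<omega>. (\<Sum>l\<le>m. E l \<omega>) \<partial>P)"
  proof (rule nn_integral_cong)
    fix \<omega> assume w: "\<omega> \<in> space P"
    have "E l \<omega> = W' l \<omega> * ennreal (exp (r * (noise k \<omega> \<bullet> U \<omega>)))" for l
      by (cases "b k \<omega> = l") (auto simp: E_def W'_def noise_def sample_def)
    then show "W \<omega> * ennreal (exp (r * (noise k \<omega> \<bullet> U \<omega>))) = (\<Sum>l\<le>m. E l \<omega>)"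
      by (simp add: sum_distrib_right[symmetric] split[OF w])
  qed
  also have "\<dots> = (\<Sum>l\<le>m. \<integral>\<^sup>+\<omega>. E l \<omega> \<partial>P)" by (rule nn_integral_sum) (use fresh_l in auto)
  also have "\<dots> \<le> (\<Sum>l\<le>m. C * (\<integral>\<^sup>+\<omega>. W' l \<omega> \<partial>P))" by (rule sum_mono) (use fresh_l in auto)
  also have "\<dots> = C * (\<integral>\<^sup>+\<omega>. (\<Sum>l\<le>m. W' l \<omega>) \<partial>P)"
    using W' by (subst nn_integral_sum) (auto simp: sum_distrib_left intro: measurable_from_subalg[OF sub])
  also have "(\<integral>\<^sup>+\<omega>. (\<Sum>l\<le>m. W' l \<omega>) \<partial>P) = (\<integral>\<^sup>+\<omega>. W \<omega> \<partial>P)"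
    by (rule nn_integral_cong) (rule split)
  finally show ?thesis unfolding U_def C_def .
qed

lemma prob_noise_ge_le:
  assumes r: "0 < r"
  shows "P.prob {\<omega> \<in> space P. t \<le> (\<Sum>k<N. noise k \<omega> \<bullet> (aux \<gamma> k \<omega> - x k \<omega>))}
    \<le> exp (real N * (4 * r\<^sup>2 * L\<^sup>2 * Theta_sq Q d) - r * t)"
proof (rule P.prob_sum_ge_le_of_exp_moments[OF sub mono])
  fix k assume k: "k < N"
  show "(\<lambda>\<omega>. noise k \<omega> \<bullet> (aux \<gamma> k \<omega> - x k \<omega>)) \<in> borel_measurable (F (Suc k))"
    using k by (intro borel_measurable_inner measurable_noise borel_measurable_diff
        measurable_F_mono[OF measurable_aux] measurable_F_mono[OF measurable_x_borel]) auto
qed (use nn_integral_exp_noise_le r in auto)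

end

context mirror_descent_process
begin

lemma regret_high_probability:
  assumes eps: "0 < \<epsilon>" and eta_eq: "\<eta> = \<epsilon> / L\<^sup>2" and sig: "0 < \<sigma>" "\<sigma> < 1 / 2" and N: "1 \<le> N"
    and steps: "2176 * Theta_sq Q d * L\<^sup>2 * ln (2 / \<sigma>) / \<epsilon>\<^sup>2 \<le> real N"
  obtains B where "B \<in> sets P" "P.prob B \<le> \<sigma>"
    "AE \<omega> in P. \<omega> \<notin> B \<longrightarrow> (\<forall>y\<in>Q. (\<Sum>k<N. A (b k \<omega>) (x k \<omega>) \<bullet> (x k \<omega> - y)) \<le> \<epsilon> * real N)"
proof -
  define l where "l = ln (2 / \<sigma>)"
  define K where "K = Theta_sq Q d * L\<^sup>2 / \<epsilon>"
  \<comment> \<open>An eighth of the main stepsize: the auxiliary stepsize term becomes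
    \<open>\<epsilon> * N / 4\<close>, at the price of \<open>8 * K\<close> for the initial
    distance.\<close>
  define \<gamma> where "\<gamma> = \<epsilon> / (8 * L\<^sup>2)"
  define t where "t = \<epsilon> * real N / 6"
  \<comment> \<open>Makes \<open>r * t = 2 * l\<close>: one \<open>l\<close> absorbs the quadratic
    term of the exponent, the other gives \<open>exp (- l) = \<sigma> / 2\<close>.\<close>
  define r where "r = 2 * l / t"
  define Y where "Y \<omega> = (\<Sum>k<N. noise k \<omega> \<bullet> (aux \<gamma> k \<omega> - x k \<omega>))" for \<omega>
  define B where "B = {\<omega> \<in> space P. t \<le> Y \<omega>}"
  \<comment> \<open>From \<open>\<sigma> < 1 / 2\<close> follows
    \<open>2 / \<sigma> > 4 > exp 1\<close>. Then \<open>l > 1\<close>, and the lower bound on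
    \<open>N\<close> in terms of \<open>K * l\<close> also controls \<open>K\<close> alone.\<close>
  have "\<sigma> * exp 1 \<le> 1 / 2 * exp 1" using sig by (intro mult_right_mono) auto
  then have "\<sigma> * exp 1 < 2" using e_less_272 by linarith
  then have "exp 1 < (2 / \<sigma>)" using sig by (simp add: field_simps)
  then have "ln (exp 1) < l" unfolding l_def using sig by (subst ln_less_cancel_iff) auto
  then have l: "1 < l" by simp
  have K: "0 \<le> K" unfolding K_def using Theta_sq_nonneg eps by simp
  have g: "0 < \<gamma>" unfolding \<gamma>_def using eps L by simp
  have t: "0 < t" unfolding t_def using eps N by simp
  have r: "0 < r" unfolding r_def using t l by simp
  have Kl: "2176 * K * l \<le> \<epsilon> * real N"
    using steps eps unfolding K_def l_def by (simp add: field_simps power2_eq_square)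
  have "K \<le> K * l" using K l mult_left_mono[of 1 l K] by simp
  then have K': "2176 * K \<le> \<epsilon> * real N" using Kl by linarith
  \<comment> \<open>Here 576 = 4 * 4 * 36: the moment constant, the square of the 2 in
    \<open>r\<close>, and the square of the 6 in \<open>t\<close>.\<close>
  have "real N * (4 * r\<^sup>2 * L\<^sup>2 * Theta_sq Q d) = 576 * l * (K * l) / (\<epsilon> * real N)"
    using eps N by (simp add: r_def t_def K_def field_simps power2_eq_square)
  also have "\<dots> \<le> l"
  proof -
    have "576 * (K * l) \<le> \<epsilon> * real N" using Kl K l mult_nonneg_nonneg[of K l] by linarith
    then have "l * (576 * (K * l)) \<le> l * (\<epsilon> * real N)" using l by (intro mult_left_mono) auto
    then show ?thesis using eps N by (simp add: divide_le_eq mult_ac)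
  qed
  finally have "real N * (4 * r\<^sup>2 * L\<^sup>2 * Theta_sq Q d) - r * t \<le> - l"
    using t by (simp add: r_def)
  then have "exp (real N * (4 * r\<^sup>2 * L\<^sup>2 * Theta_sq Q d) - r * t) \<le> exp (- l)" by simp
  also have "\<dots> = \<sigma> / 2" using sig by (simp add: l_def exp_minus)
  also have "\<dots> \<le> \<sigma>" using sig by simp
  finally have prob: "P.prob B \<le> \<sigma>"
    unfolding B_def Y_def using prob_noise_ge_le[OF r, of t \<gamma>] by simp
  have "Y \<in> borel_measurable P"
    unfolding Y_def
  proof (intro borel_measurable_sum borel_measurable_inner borel_measurable_diff)
    fix k assume "k \<in> {..<N}"
    then show "noise k \<in> borel_measurable P" "aux \<gamma> k \<in> borel_measurable P" "x k \<in> borel_measurable P"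
      using measurable_from_subalg[OF sub measurable_noise[of k]]
        measurable_from_subalg[OF sub measurable_aux[of k \<gamma>]]
        measurable_from_subalg[OF sub measurable_x_borel[of k]] by auto
  qed
  then have B: "B \<in> sets P" unfolding B_def by measurable
  have "AE \<omega> in P. \<omega> \<in> space P" by simp
  with AE_bounded have "AE \<omega> in P. \<omega> \<notin> B \<longrightarrow>
      (\<forall>y\<in>Q. (\<Sum>k<N. A (b k \<omega>) (x k \<omega>) \<bullet> (x k \<omega> - y)) \<le> \<epsilon> * real N)"
  proof eventually_elim
    case (elim \<omega>)
    show ?case
    proof (intro impI ballI)
      fix y assume "\<omega> \<notin> B" and y: "y \<in> Q"
      then have Yt: "Y \<omega> \<le> t" using elim unfolding B_def by auto
      have "(\<Sum>k<N. A (b k \<omega>) (x k \<omega>) \<bullet> (x k \<omega> - y)) \<le>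
          Theta_sq Q d / \<eta> + real N * \<eta> * L\<^sup>2 / 2 + Theta_sq Q d / \<gamma> + 2 * real N * \<gamma> * L\<^sup>2 + Y \<omega>"
        unfolding Y_def using elim by (intro regret_le y g) auto
      \<comment> \<open>The four terms are \<open>K\<close>, \<open>\<epsilon> * N / 2\<close>,
        \<open>8 * K\<close> and \<open>\<epsilon> * N / 4\<close>. With \<open>Y \<omega>\<close>
        at most a sixth of \<open>\<epsilon> * N\<close>, a twelfth is left for
        \<open>9 * K\<close>.\<close>
      also have "\<dots> = 9 * K + 3 / 4 * (\<epsilon> * real N) + Y \<omega>"
        using eps L by (simp add: eta_eq \<gamma>_def K_def field_simps)
      also have "\<dots> \<le> \<epsilon> * real N" using K' K Yt unfolding t_def by linarith
      finally show "(\<Sum>k<N. A (b k \<omega>) (x k \<omega>) \<bullet> (x k \<omega> - y)) \<le> \<epsilon> * real N" .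
    qed
  qed
  with B prob show ?thesis by (rule that)
qed

end

section \<open>From small regret to a primal-dual solution\<close>

lemma convex_on_primal_output:
  assumes Q: "convex Q" and f: "convex_on Q f" and A: "finite A" "A \<noteq> {}" "\<And>k. k \<in> A \<Longrightarrow> X k \<in> Q"
  shows "f (primal_output A X) \<le> (\<Sum>k\<in>A. f (X k)) / real (card A)"
proof -
  have "f (\<Sum>k\<in>A. (1 / real (card A)) *\<^sub>R X k) \<le> (\<Sum>k\<in>A. 1 / real (card A) * f (X k))"
    using A by (intro convex_on_sum[OF _ _ f]) auto
  then show ?thesis
    by (simp add: primal_output_def scaleR_sum_right sum_divide_distrib)
qed

lemma primal_output_in:
  assumes Q: "convex Q" and A: "finite A" "A \<noteq> {}" "\<And>k. k \<in> A \<Longrightarrow> X k \<in> Q"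
  shows "primal_output A X \<in> Q"
proof -
  have "(\<Sum>k\<in>A. (1 / real (card A)) *\<^sub>R X k) \<in> Q"
    using A by (intro convex_sum Q) auto
  then show ?thesis by (simp add: primal_output_def scaleR_sum_right)
qed

text \<open>Exchanging the sums turns the Lagrangian term into an average of the chosen constraints
  over nonproductive steps, the form in which regret delivers it.\<close>

lemma sum_dual_output:
  assumes "\<And>k. k \<in> J \<Longrightarrow> c k \<in> {1..m}"
  shows "(\<Sum>l=1..m. dual_output I J c l * u l) = (\<Sum>k\<in>J. u (c k)) / real (card I)"
proof -
  have "(\<Sum>l=1..m. (\<Sum>k\<in>J. of_bool (l = c k)) * u l) = (\<Sum>l=1..m. \<Sum>k\<in>J. of_bool (l = c k) * u l)"
    by (simp add: sum_distrib_right)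
  also have "\<dots> = (\<Sum>k\<in>J. \<Sum>l=1..m. of_bool (l = c k) * u l)" by (rule sum.swap)
  also have "\<dots> = (\<Sum>k\<in>J. u (c k))"
  proof (rule sum.cong)
    fix k assume "k \<in> J"
    then have "(\<Sum>l=1..m. if l = c k then u l else 0) = u (c k)" using assms by (subst sum.delta) auto
    moreover have "(\<Sum>l=1..m. of_bool (l = c k) * u l) = (\<Sum>l=1..m. if l = c k then u l else 0)"
      by (rule sum.cong) auto
    ultimately show "(\<Sum>l=1..m. of_bool (l = c k) * u l) = u (c k)" by simp
  qed simp
  finally show ?thesis
    unfolding dual_output_def by (simp add: sum_divide_distrib[symmetric] mult.assoc)
qed

lemma primal_dual_approx_of_regret:
  fixes Q :: "'a::real_inner set" and X :: "nat \<Rightarrow> 'a"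
  assumes Q: "convex Q" and convex: "convex_on Q f" "\<And>l. l \<in> {1..m} \<Longrightarrow> convex_on Q (g l)"
    and subgrad_f: "\<And>y. y \<in> Q \<Longrightarrow> is_subgradient Q f y (gradf y)"
    and subgrad_g: "\<And>l y. l \<in> {1..m} \<Longrightarrow> y \<in> Q \<Longrightarrow> is_subgradient Q (g l) y (gradg l y)"
    and slater: "\<exists>y\<in>Q. \<forall>l\<in>{1..m}. g l y < 0"
    and approx: "\<And>l y. l \<in> {1..m} \<Longrightarrow> y \<in> Q \<Longrightarrow> \<bar>h l y - g l y\<bar> \<le> \<delta>"
    and N: "1 \<le> N" and X: "\<And>k. k < N \<Longrightarrow> X k \<in> Q"
    and c: "\<And>k. k < N \<Longrightarrow> \<not> productive m h (\<epsilon> + \<delta>) (X k) \<Longrightarrow> is_arg_max (\<lambda>l. h l (X k)) (\<lambda>l. l \<in> {1..m}) (c k)"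
    and regret: "\<And>y. y \<in> Q \<Longrightarrow> (\<Sum>k<N. (if productive m h (\<epsilon> + \<delta>) (X k) then gradf (X k) else gradg (c k) (X k)) \<bullet> (X k - y))
      \<le> \<epsilon> * real N"
  defines "I \<equiv> productive_steps m h (\<epsilon> + \<delta>) N X" and "J \<equiv> nonproductive_steps m h (\<epsilon> + \<delta>) N X"
  shows "I \<noteq> {} \<and> primal_dual_approx Q f m g \<epsilon> (\<epsilon> + 2 * \<delta>) (primal_output I X) (dual_output I J c)"
proof -
  have I: "k < N" "X k \<in> Q" "productive m h (\<epsilon> + \<delta>) (X k)" if "k \<in> I" for k
    using that X by (auto simp: I_def productive_steps_def)
  have J: "k < N" "X k \<in> Q" "\<not> productive m h (\<epsilon> + \<delta>) (X k)" if "k \<in> J" for k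
    using that X by (auto simp: J_def nonproductive_steps_def)
  have fin: "finite I" "finite J" "I \<inter> J = {}" and IJ: "I \<union> J = {..<N}"
    by (auto simp: I_def J_def productive_steps_def nonproductive_steps_def)
  have split: "sum u {..<N} = sum u I + sum u J" for u :: "nat \<Rightarrow> real"
    unfolding IJ[symmetric] by (rule sum.union_disjoint[OF fin])
  have card: "real N = real (card I) + real (card J)"
    using card_Un_disjoint[OF fin] IJ by simp
  \<comment> \<open>Some constraint exceeds the threshold, hence so does the maximal one; the
    \<open>\<delta>\<close> in the threshold pays for its approximation error.\<close>
  have cJ: "c k \<in> {1..m}" and gJ: "\<epsilon> < g (c k) (X k)" if k: "k \<in> J" for k
  proof -
    have max: "c k \<in> {1..m}" "\<And>l. l \<in> {1..m} \<Longrightarrow> h l (X k) \<le> h (c k) (X k)"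
      using c[OF J(1,3)[OF k]] by (auto simp: is_arg_max_linorder)
    then show "c k \<in> {1..m}" by simp
    obtain l where "l \<in> {1..m}" "\<epsilon> + \<delta> < h l (X k)" using J(3)[OF k] by (auto simp: productive_def not_le)
    then have "\<epsilon> + \<delta> < h (c k) (X k)" using max(2)[of l] by linarith
    then show "\<epsilon> < g (c k) (X k)" using approx[OF max(1) J(2)[OF k]] by linarith
  qed
  have main: "(\<Sum>k\<in>I. f (X k) - f y) + (\<Sum>k\<in>J. g (c k) (X k) - g (c k) y) \<le> \<epsilon> * real N" if y: "y \<in> Q" for y
  proof -
    have "(\<Sum>k\<in>I. f (X k) - f y) \<le> (\<Sum>k\<in>I. gradf (X k) \<bullet> (X k - y))"
    proof (rule sum_mono)
      fix k assume "k \<in> I"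
      then have "f (X k) + gradf (X k) \<bullet> (y - X k) \<le> f y"
        using subgrad_f[OF I(2)] y unfolding is_subgradient_def by blast
      then show "f (X k) - f y \<le> gradf (X k) \<bullet> (X k - y)" by (simp add: inner_diff_right)
    qed
    moreover have "(\<Sum>k\<in>J. g (c k) (X k) - g (c k) y) \<le> (\<Sum>k\<in>J. gradg (c k) (X k) \<bullet> (X k - y))"
    proof (rule sum_mono)
      fix k assume k: "k \<in> J"
      then have "g (c k) (X k) + gradg (c k) (X k) \<bullet> (y - X k) \<le> g (c k) y"
        using subgrad_g[OF cJ[OF k] J(2)[OF k]] y unfolding is_subgradient_def by blast
      then show "g (c k) (X k) - g (c k) y \<le> gradg (c k) (X k) \<bullet> (X k - y)" by (simp add: inner_diff_right)
    qed
    moreover have "(\<Sum>k<N. (if productive m h (\<epsilon> + \<delta>) (X k) then gradf (X k) else gradg (c k) (X k)) \<bullet> (X k - y)) =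
        (\<Sum>k\<in>I. gradf (X k) \<bullet> (X k - y)) + (\<Sum>k\<in>J. gradg (c k) (X k) \<bullet> (X k - y))"
      unfolding split using I(3) J(3) by (intro arg_cong2[where f="(+)"] sum.cong) auto
    ultimately show ?thesis using regret[OF y] by linarith
  qed
  have ne: "I \<noteq> {}"
  proof
    \<comment> \<open>If all steps were nonproductive, each would contribute more than
      \<open>\<epsilon>\<close> to the sum compared with the Slater point. As \<open>N\<close> is
      positive, the total would exceed \<open>\<epsilon> * N\<close>.\<close>
    assume I: "I = {}"
    obtain y where y: "y \<in> Q" "\<And>l. l \<in> {1..m} \<Longrightarrow> g l y < 0" using slater by blast
    have "0 \<in> {..<N}" using N by simp
    then have "J \<noteq> {}" using IJ I by auto
    then have "(\<Sum>k\<in>J. \<epsilon>) < (\<Sum>k\<in>J. g (c k) (X k) - g (c k) y)"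
    proof (rule sum_strict_mono[OF fin(2)])
      show "\<epsilon> < g (c k) (X k) - g (c k) y" if "k \<in> J" for k
        using gJ[OF that] y(2)[OF cJ[OF that]] by linarith
    qed
    then show False using main[OF y(1)] I card by (simp add: mult.commute)
  qed
  then have cI: "0 < real (card I)" using fin by (simp add: card_gt_0_iff)
  have lower: "f (primal_output I X) - \<epsilon> \<le> f y + (\<Sum>l=1..m. dual_output I J c l * g l y)" if y: "y \<in> Q" for y
  proof -
    \<comment> \<open>Nonproductive steps pay their own share \<open>\<epsilon> * card J\<close> of
      the regret budget; what remains is \<open>\<epsilon> * card I\<close>, which averaging over
      \<open>I\<close> turns into \<open>\<epsilon>\<close>.\<close>
    have "real (card J) * \<epsilon> \<le> (\<Sum>k\<in>J. g (c k) (X k))"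
      using sum_mono[of J "\<lambda>_. \<epsilon>" "\<lambda>k. g (c k) (X k)"] gJ by (simp add: less_imp_le)
    then have "(\<Sum>k\<in>I. f (X k)) \<le> real (card I) * f y + (\<Sum>k\<in>J. g (c k) y) + \<epsilon> * real (card I)"
      using main[OF y] by (simp add: sum_subtractf card algebra_simps)
    then have "(\<Sum>k\<in>I. f (X k)) / real (card I) \<le> f y + (\<Sum>k\<in>J. g (c k) y) / real (card I) + \<epsilon>"
      using cI by (simp add: field_simps)
    moreover have "f (primal_output I X) \<le> (\<Sum>k\<in>I. f (X k)) / real (card I)"
      by (rule convex_on_primal_output[OF Q convex(1) fin(1) ne I(2)])
    ultimately show ?thesis using sum_dual_output[of J c m I "\<lambda>l. g l y"] cJ by simp
  qed
  have "Q \<noteq> {}" using slater by blast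
  then have "f (primal_output I X) - \<epsilon> \<le> dual_fun Q f m g (dual_output I J c)"
    unfolding dual_fun_def by (rule cINF_greatest) (rule lower)
  then have "duality_gap Q f m g (primal_output I X) (dual_output I J c) \<le> \<epsilon>"
    unfolding duality_gap_def by simp
  moreover have "primal_output I X \<in> Q" by (rule primal_output_in[OF Q fin(1) ne I(2)])
  moreover have "0 \<le> dual_output I J c l" for l by (simp add: dual_output_def sum_nonneg)
  moreover have "g l (primal_output I X) \<le> \<epsilon> + 2 * \<delta>" if l: "l \<in> {1..m}" for l
  proof -
    \<comment> \<open>One \<open>\<delta>\<close> comes from the test threshold, the other from
      replacing the approximate value by the true one.\<close>
    have "g l (X k) \<le> \<epsilon> + 2 * \<delta>" if k: "k \<in> I" for k
    proof -
      have "h l (X k) \<le> \<epsilon> + \<delta>" using I(3)[OF k] l unfolding productive_def by blast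
      then show ?thesis using approx[OF l I(2)[OF k]] by linarith
    qed
    then have "(\<Sum>k\<in>I. g l (X k)) \<le> real (card I) * (\<epsilon> + 2 * \<delta>)"
      using sum_bounded_above[of I "\<lambda>k. g l (X k)"] by simp
    then have "(\<Sum>k\<in>I. g l (X k)) / real (card I) \<le> \<epsilon> + 2 * \<delta>" using cI by (simp add: divide_le_eq mult.commute)
    moreover have "g l (primal_output I X) \<le> (\<Sum>k\<in>I. g l (X k)) / real (card I)"
      by (rule convex_on_primal_output[OF Q convex(2)[OF l] fin(1) ne I(2)])
    ultimately show ?thesis by simp
  qed
  ultimately show ?thesis using ne by (simp add: primal_dual_approx_def)
qed

text \<open>Lists over a countable type are again countable, so a whole history of indices can be
  treated as a single discrete random variable.\<close>

lemma measurable_map_count_space: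
  fixes H :: "nat \<Rightarrow> 'w \<Rightarrow> 'b::countable"
  assumes "\<And>k. k \<in> set ks \<Longrightarrow> H k \<in> measurable M (count_space UNIV)"
  shows "(\<lambda>\<omega>. map (\<lambda>k. H k \<omega>) ks) \<in> measurable M (count_space UNIV)"
  using assms
proof (induction ks)
  case (Cons k ks)
  then have H: "H k \<in> measurable M (count_space UNIV)"
    and rest: "(\<lambda>\<omega>. map (\<lambda>k. H k \<omega>) ks) \<in> measurable M (count_space UNIV)" by auto
  have "(\<lambda>\<omega>. H k \<omega> # map (\<lambda>k. H k \<omega>) ks) \<in> measurable M (count_space UNIV)"
    by (rule measurable_compose_countable[where f="\<lambda>a \<omega>. a # map (\<lambda>k. H k \<omega>) ks", OF _ H])
      (rule measurable_compose[OF rest measurable_count_space])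
  then show ?case by simp
qed simp

lemma lipschitz_wrt_continuous_on:
  fixes p :: "'a::euclidean_space \<Rightarrow> real"
  assumes p: "is_norm p" and f: "lipschitz_wrt p L Q f" and L: "0 \<le> L"
  shows "continuous_on Q f"
proof -
  define C where "C = (\<Sum>b\<in>Basis. p (b :: 'a))"
  have C: "0 \<le> C" unfolding C_def by (intro sum_nonneg is_norm_nonneg p)
  have "(L * C)-lipschitz_on Q f"
  proof (rule lipschitz_onI)
    fix x y assume "x \<in> Q" "y \<in> Q"
    then have "\<bar>f x - f y\<bar> \<le> L * p (x - y)" using f unfolding lipschitz_wrt_def by blast
    also have "\<dots> \<le> L * (C * norm (x - y))"
      unfolding C_def by (intro mult_left_mono is_norm_upper p L)
    finally show "dist (f x) (f y) \<le> L * C * dist x y" by (simp add: dist_norm mult.assoc)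
  qed (use C L in simp)
  then show ?thesis by (rule lipschitz_on_continuous_on)
qed

text \<open>The multipliers take countably many values, which makes the event measurable although the dual
  function is an infimum over the uncountable set \<open>Q\<close>: decompose it along the list of indices \<open>b\<close>.\<close>

lemma measurable_primal_dual_event:
  fixes b :: "nat \<Rightarrow> 'w \<Rightarrow> nat" and x :: "nat \<Rightarrow> 'w \<Rightarrow> 'a::euclidean_space"
  assumes Q: "convex Q" and f: "continuous_on Q f" and g: "\<And>l. l \<in> {1..m} \<Longrightarrow> continuous_on Q (g l)"
    and b: "\<And>k. k < N \<Longrightarrow> b k \<in> measurable P (count_space UNIV)"
    and x: "\<And>k. k < N \<Longrightarrow> x k \<in> borel_measurable P" "\<And>k \<omega>. k < N \<Longrightarrow> \<omega> \<in> space P \<Longrightarrow> x k \<omega> \<in> Q"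
  shows "{\<omega> \<in> space P. {k. k < N \<and> b k \<omega> = 0} \<noteq> {} \<and>
      primal_dual_approx Q f m g e\<^sub>f e\<^sub>g (primal_output {k. k < N \<and> b k \<omega> = 0} (\<lambda>k. x k \<omega>))
        (dual_output {k. k < N \<and> b k \<omega> = 0} {k. k < N \<and> b k \<omega> \<noteq> 0} (\<lambda>k. b k \<omega>))} \<in> sets P"
proof -
  define h where "h \<omega> = map (\<lambda>k. b k \<omega>) [0..<N]" for \<omega>
  define I where "I ls = {k. k < N \<and> ls ! k = (0::nat)}" for ls
  define J where "J ls = {k. k < N \<and> ls ! k \<noteq> (0::nat)}" for ls
  define lam where "lam ls = dual_output (I ls) (J ls) (\<lambda>k. ls ! k)" for ls
  define R where "R ls \<omega> \<longleftrightarrow> I ls \<noteq> {} \<and>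
    primal_dual_approx Q f m g e\<^sub>f e\<^sub>g (primal_output (I ls) (\<lambda>k. x k \<omega>)) (lam ls)" for ls \<omega>
  have h: "h \<in> measurable P (count_space UNIV)"
    unfolding h_def by (rule measurable_map_count_space) (use b in auto)
  have R: "R ls \<in> measurable P (count_space UNIV)" for ls
  proof (cases "I ls = {}")
    case False
    define X where "X \<omega> = primal_output (I ls) (\<lambda>k. x k \<omega>)" for \<omega>
    have XQ: "X \<omega> \<in> Q" if "\<omega> \<in> space P" for \<omega>
      unfolding X_def using that False by (intro primal_output_in Q) (auto simp: I_def x)
    have "X \<in> borel_measurable P"
      unfolding X_def primal_output_def
      by (intro borel_measurable_scaleR borel_measurable_const borel_measurable_sum x) (auto simp: I_def)
    then have X: "X \<in> measurable P (restrict_space borel Q)"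
      using XQ by (intro measurable_restrict_space2) auto
    have fX: "(\<lambda>\<omega>. f (X \<omega>)) \<in> borel_measurable P"
      by (rule measurable_compose[OF X borel_measurable_continuous_on_restrict[OF f]])
    have gX: "(\<lambda>\<omega>. g l (X \<omega>)) \<in> borel_measurable P" if "l \<in> {1..m}" for l
      by (rule measurable_compose[OF X borel_measurable_continuous_on_restrict[OF g[OF that]]])
    have "Measurable.pred P (\<lambda>\<omega>. f (X \<omega>) - dual_fun Q f m g (lam ls) \<le> e\<^sub>f)"
      using fX by measurable
    moreover have "Measurable.pred P (\<lambda>\<omega>. \<forall>l\<in>{1..m}. g l (X \<omega>) \<le> e\<^sub>g)"
    proof (rule pred_intros_finite)
      show "Measurable.pred P (\<lambda>\<omega>. g l (X \<omega>) \<le> e\<^sub>g)" if "l \<in> {1..m}" for l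
        using gX[OF that] by measurable
    qed simp
    moreover have "Measurable.pred P (\<lambda>\<omega>. \<forall>l\<in>{1..m}. 0 \<le> lam ls l)" by simp
    ultimately have pred: "Measurable.pred P (\<lambda>\<omega>. (\<forall>l\<in>{1..m}. 0 \<le> lam ls l) \<and>
        f (X \<omega>) - dual_fun Q f m g (lam ls) \<le> e\<^sub>f \<and> (\<forall>l\<in>{1..m}. g l (X \<omega>) \<le> e\<^sub>g))"
      unfolding pred_def by (intro sets.sets_Collect_conj)
    have R_iff: "R ls \<omega> \<longleftrightarrow> (\<forall>l\<in>{1..m}. 0 \<le> lam ls l) \<and>
        f (X \<omega>) - dual_fun Q f m g (lam ls) \<le> e\<^sub>f \<and> (\<forall>l\<in>{1..m}. g l (X \<omega>) \<le> e\<^sub>g)" if "\<omega> \<in> space P" for \<omega>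
      using XQ[OF that] False by (simp add: R_def primal_dual_approx_def duality_gap_def X_def)
    show ?thesis by (rule measurable_cong[THEN iffD2, OF _ pred]) (rule R_iff)
  next
    case True
    then have "R ls = (\<lambda>_. False)" by (simp add: R_def fun_eq_iff)
    then show ?thesis by simp
  qed
  have "(\<lambda>\<omega>. R (h \<omega>) \<omega>) \<in> measurable P (count_space UNIV)"
    by (rule measurable_compose_countable[where f=R, OF R h])
  then have "{\<omega> \<in> space P. R (h \<omega>) \<omega>} \<in> sets P" by (simp add: pred_def)
  moreover have I: "I (h \<omega>) = {k. k < N \<and> b k \<omega> = 0}" and J: "J (h \<omega>) = {k. k < N \<and> b k \<omega> \<noteq> 0}" for \<omega>
    by (auto simp: I_def J_def h_def)
  moreover have "lam (h \<omega>) = dual_output {k. k < N \<and> b k \<omega> = 0} {k. k < N \<and> b k \<omega> \<noteq> 0} (\<lambda>k. b k \<omega>)" for \<omega>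
    unfolding lam_def dual_output_def I J
    by (intro ext arg_cong2[where f="(*)"] sum.cong refl) (auto simp: h_def)
  ultimately show ?thesis by (simp only: R_def)
qed

section \<open>The convergence theorem\<close>

theorem theorem2:
  fixes nrm :: "'a::euclidean_space \<Rightarrow> real" and Q :: "'a set"
    and f :: "'a \<Rightarrow> real" and g :: "nat \<Rightarrow> 'a \<Rightarrow> real" and m :: nat
    and gradf :: "'a \<Rightarrow> 'a" and gradg :: "nat \<Rightarrow> 'a \<Rightarrow> 'a"
    and g\<^sub>\<delta> :: "nat \<Rightarrow> 'a \<Rightarrow> real"
    and d :: "'a \<Rightarrow> real" and gd :: "'a \<Rightarrow> 'a"
    and S :: "'s measure" and T :: "nat \<Rightarrow> 't measure"
    and Gf :: "'a \<Rightarrow> 's \<Rightarrow> 'a" and Gg :: "nat \<Rightarrow> 'a \<Rightarrow> 't \<Rightarrow> 'a"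
    and P :: "'w measure" and F :: "nat \<Rightarrow> 'w measure"
    and \<xi> :: "nat \<Rightarrow> 'w \<Rightarrow> 's" and \<zeta> :: "nat \<Rightarrow> nat \<Rightarrow> 'w \<Rightarrow> 't"
    and c :: "nat \<Rightarrow> 'w \<Rightarrow> nat" and x :: "nat \<Rightarrow> 'w \<Rightarrow> 'a"
    and I J :: "'w \<Rightarrow> nat set"
    and M \<epsilon> \<delta> \<sigma> :: real and N :: nat
  assumes \<comment> \<open>the convex problem\<close>
        norm: "is_norm nrm"
    and Q: "convex Q" "compact Q"
    and convex: "convex_on Q f" "\<And>l. l \<in> {1..m} \<Longrightarrow> convex_on Q (g l)"
    and subgrad_f: "\<And>y. y \<in> Q \<Longrightarrow> is_subgradient Q f y (gradf y)"
    and subgrad_g: "\<And>l y. l \<in> {1..m} \<Longrightarrow> y \<in> Q \<Longrightarrow> is_subgradient Q (g l) y (gradg l y)"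
    and slater: "\<exists>y\<in>Q. \<forall>l\<in>{1..m}. g l y < 0"
    and M: "M > 0"
    and lipschitz: "lipschitz_wrt nrm M Q f" "\<And>l. l \<in> {1..m} \<Longrightarrow> lipschitz_wrt nrm M Q (g l)"
      \<comment> \<open>the prox-structure\<close>
    and prox: "prox_function nrm Q d gd"
      \<comment> \<open>the stochastic subgradients; \<open>S\<close> and \<open>T l\<close> are the laws of the samples\<close>
    and laws: "prob_space S" "\<And>l. l \<in> {1..m} \<Longrightarrow> prob_space (T l)"
    and meas_f: "(\<lambda>(y, s). Gf y s) \<in> borel_measurable (restrict_space borel Q \<Otimes>\<^sub>M S)"
    and meas_g: "\<And>l. l \<in> {1..m} \<Longrightarrow>
          (\<lambda>(y, t). Gg l y t) \<in> borel_measurable (restrict_space borel Q \<Otimes>\<^sub>M T l)"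
    and unbiased_f: "\<And>y. y \<in> Q \<Longrightarrow> has_bochner_integral S (Gf y) (gradf y)"
    and unbiased_g: "\<And>l y. l \<in> {1..m} \<Longrightarrow> y \<in> Q \<Longrightarrow> has_bochner_integral (T l) (Gg l y) (gradg l y)"
    and bounded_f: "\<And>y. y \<in> Q \<Longrightarrow> AE s in S. dual_norm nrm (Gf y s) \<le> M"
    and bounded_g: "\<And>l y. l \<in> {1..m} \<Longrightarrow> y \<in> Q \<Longrightarrow> AE t in T l. dual_norm nrm (Gg l y t) \<le> M"
      \<comment> \<open>the parameters and the approximate constraint values\<close>
    and params: "\<epsilon> > 0" "\<delta> \<ge> 0" "0 < \<sigma>" "\<sigma> < 1 / 2"
    and approx: "\<And>l y. l \<in> {1..m} \<Longrightarrow> y \<in> Q \<Longrightarrow> \<bar>g\<^sub>\<delta> l y - g l y\<bar> \<le> \<delta>"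
    and meas_approx: "\<And>l. l \<in> {1..m} \<Longrightarrow> g\<^sub>\<delta> l \<in> borel_measurable (restrict_space borel Q)"
      \<comment> \<open>the samples: \<open>F k\<close> is the information available before the samples of step \<open>k\<close> are drawn\<close>
    and P: "prob_space P"
    and filtration: "filtration (space P) F" "\<And>k. subalgebra P (F k)"
    and choice_past: "\<And>k. k < N \<Longrightarrow> c k \<in> measurable (F k) (count_space UNIV)"
    and sample_f: "\<And>k. k < N \<Longrightarrow> \<xi> k \<in> measurable (F (Suc k)) S"
          "\<And>k. k < N \<Longrightarrow> distr P S (\<xi> k) = S"
          "\<And>k. k < N \<Longrightarrow> prob_space.indep_set P (sets (F k)) (sets (vimage_algebra (space P) (\<xi> k) S))"
    and sample_g: "\<And>k l. k < N \<Longrightarrow> l \<in> {1..m} \<Longrightarrow> \<zeta> k l \<in> measurable (F (Suc k)) (T l)"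
          "\<And>k l. k < N \<Longrightarrow> l \<in> {1..m} \<Longrightarrow> distr P (T l) (\<zeta> k l) = T l"
          "\<And>k l. k < N \<Longrightarrow> l \<in> {1..m} \<Longrightarrow> prob_space.indep_set P (sets (F k)) (sets (vimage_algebra (space P) (\<zeta> k l) (T l)))"
      \<comment> \<open>the algorithm\<close>
    and run: "\<And>\<omega>. \<omega> \<in> space P \<Longrightarrow>
          mirror_descent_run Q d gd Gf m Gg g\<^sub>\<delta> (\<epsilon> + \<delta>) (\<epsilon> / M\<^sup>2) N
            (\<lambda>k. \<xi> k \<omega>) (\<lambda>k l. \<zeta> k l \<omega>) (\<lambda>k. c k \<omega>) (\<lambda>k. x k \<omega>)"
    and steps: "N \<ge> 1"
          "real N \<ge> 128 * Theta_sq Q d * M\<^sup>2 *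
             (17 * ln (2 / \<sigma>) + 2 * nemirovski_const (dual_norm nrm)) / \<epsilon>\<^sup>2"
  defines "I \<equiv> \<lambda>\<omega>. productive_steps m g\<^sub>\<delta> (\<epsilon> + \<delta>) N (\<lambda>k. x k \<omega>)"
    and "J \<equiv> \<lambda>\<omega>. nonproductive_steps m g\<^sub>\<delta> (\<epsilon> + \<delta>) N (\<lambda>k. x k \<omega>)"
  shows "measure P {\<omega> \<in> space P. I \<omega> \<noteq> {} \<and>
            primal_dual_approx Q f m g \<epsilon> (\<epsilon> + 2 * \<delta>)
              (primal_output (I \<omega>) (\<lambda>k. x k \<omega>))
              (dual_output (I \<omega>) (J \<omega>) (\<lambda>k. c k \<omega>))}
         \<ge> 1 - \<sigma>"
proof -
  interpret P: prob_space P by (rule P)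
  define \<theta> where "\<theta> = \<epsilon> + \<delta>"
  \<comment> \<open>Index 0 is free because constraints start at 1, so it encodes a productive step;
    the arbitrary value of \<open>c k \<omega>\<close> there is masked.\<close>
  define b where "b k \<omega> = (if productive m g\<^sub>\<delta> \<theta> (x k \<omega>) then 0 else c k \<omega>)" for k \<omega>
  define V where "V l k y \<omega> = (if l = 0 then Gf y (\<xi> k \<omega>) else Gg l y (\<zeta> k l \<omega>))" for l k y \<omega>
  define A where "A l = (if l = 0 then gradf else gradg l)" for l
  have run_0: "x 0 \<omega> = prox_center Q d" if "\<omega> \<in> space P" for \<omega>
    using run[OF that] unfolding mirror_descent_run_def by blast
  have choice: "is_arg_max (\<lambda>l. g\<^sub>\<delta> l (x k \<omega>)) (\<lambda>l. l \<in> {1..m}) (c k \<omega>)"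
    if "\<omega> \<in> space P" "k < N" "\<not> productive m g\<^sub>\<delta> \<theta> (x k \<omega>)" for k \<omega>
    using run[OF that(1)] that(2,3) unfolding mirror_descent_run_def \<theta>_def by metis
  have c_in: "c k \<omega> \<in> {1..m}" if "\<omega> \<in> space P" "k < N" "\<not> productive m g\<^sub>\<delta> \<theta> (x k \<omega>)" for k \<omega>
    using choice[OF that] by (simp add: is_arg_max_def)
  have run_Suc: "x (Suc k) \<omega> = mirr Q d gd (x k \<omega>) ((\<epsilon> / M\<^sup>2) *\<^sub>R V (b k \<omega>) k (x k \<omega>) \<omega>)"
    if "k < N" "\<omega> \<in> space P" for k \<omega>
  proof (cases "productive m g\<^sub>\<delta> \<theta> (x k \<omega>)")
    case True
    then show ?thesis using run[OF that(2)] that(1) unfolding mirror_descent_run_def \<theta>_def by (simp add: b_def V_def \<theta>_def)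
  next
    case False
    then have "x (Suc k) \<omega> = mirr Q d gd (x k \<omega>) ((\<epsilon> / M\<^sup>2) *\<^sub>R Gg (c k \<omega>) (x k \<omega>) (\<zeta> k (c k \<omega>) \<omega>))"
      using run[OF that(2)] that(1) unfolding mirror_descent_run_def \<theta>_def by metis
    then show ?thesis using False c_in[OF that(2,1) False] by (simp add: b_def V_def)
  qed
  have mono: "sets (F i) \<subseteq> sets (F j)" if "i \<le> j" for i j
    using filtration.sets_F_mono[OF filtration(1) that] .
  have fresh: "fresh_subgradient nrm Q M P (F k) (F (Suc k)) (V l k) (A l)" if k: "k < N" and l: "l \<le> m" for k l
  proof (cases "l = 0")
    case True
    interpret stochastic_gradient S nrm Q Gf gradf M
      using laws(1) norm meas_f unbiased_f bounded_f M
      by (simp add: stochastic_gradient_def stochastic_gradient_axioms_def)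
    have "fresh_subgradient nrm Q M P (F k) (F (Suc k)) (\<lambda>y \<omega>. Gf y (\<xi> k \<omega>)) gradf"
      by (rule fresh_subgradient[OF P filtration(2,2) mono sample_f[OF k]]) simp
    then show ?thesis using True by (simp add: V_def[abs_def] A_def)
  next
    case False
    then have l': "l \<in> {1..m}" using l by simp
    interpret stochastic_gradient "T l" nrm Q "Gg l" "gradg l" M
      using laws(2)[OF l'] norm meas_g[OF l'] unbiased_g[OF l'] bounded_g[OF l'] M
      by (simp add: stochastic_gradient_def stochastic_gradient_axioms_def)
    have "fresh_subgradient nrm Q M P (F k) (F (Suc k)) (\<lambda>y \<omega>. Gg l y (\<zeta> k l \<omega>)) (gradg l)"
      by (rule fresh_subgradient[OF P filtration(2,2) mono sample_g[OF k l']]) simp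
    then show ?thesis using False by (simp add: V_def[abs_def] A_def)
  qed
  have spF: "space (F k) = space P" for k using filtration(2)[of k] by (simp add: subalgebra_def)
  have index: "b k \<in> measurable (F k) (count_space {..m})"
    if k: "k < N" and xk: "x k \<in> measurable (F k) (restrict_space borel Q)" for k
  proof -
    have "{\<omega> \<in> space (F k). productive m g\<^sub>\<delta> \<theta> (x k \<omega>)} \<in> sets (F k)"
      unfolding productive_def
    proof (rule sets.sets_Collect_finite_All)
      fix l assume "l \<in> {1..m}"
      from measurable_compose[OF xk meas_approx[OF this]]
      show "{\<omega> \<in> space (F k). g\<^sub>\<delta> l (x k \<omega>) \<le> \<theta>} \<in> sets (F k)" by measurable
    qed auto
    then have "b k \<in> measurable (F k) (count_space UNIV)"
      unfolding b_def by (intro measurable_If choice_past k) auto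
    then show ?thesis
      using c_in[OF _ k] by (intro measurable_count_space_extend[of "{..m}" UNIV]) (auto simp: b_def spF)
  qed
  have Qne: "Q \<noteq> {}" using slater by blast
  interpret mirror_descent_process nrm Q d gd P F N m M "\<epsilon> / M\<^sup>2" V A b x
    by unfold_locales (use norm Q Qne prox filtration(2) mono M params fresh index run_0 run_Suc in auto)
  \<comment> \<open>The constant is 2176 = 128 * 17, the logarithmic part of the prescribed number
    of steps.\<close>
  have "2176 * Theta_sq Q d * M\<^sup>2 * ln (2 / \<sigma>) / \<epsilon>\<^sup>2 \<le>
      128 * Theta_sq Q d * M\<^sup>2 * (17 * ln (2 / \<sigma>) + 2 * nemirovski_const (dual_norm nrm)) / \<epsilon>\<^sup>2"
  proof (rule divide_right_mono)
    have "0 \<le> (128 * Theta_sq Q d * M\<^sup>2) * (2 * nemirovski_const (dual_norm nrm))"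
      using Theta_sq_nonneg nemirovski_const_nonneg[OF is_norm_dual_norm[OF norm]] by simp
    then show "2176 * Theta_sq Q d * M\<^sup>2 * ln (2 / \<sigma>) \<le>
        128 * Theta_sq Q d * M\<^sup>2 * (17 * ln (2 / \<sigma>) + 2 * nemirovski_const (dual_norm nrm))"
      by (simp add: distrib_left)
  qed simp
  then have "2176 * Theta_sq Q d * M\<^sup>2 * ln (2 / \<sigma>) / \<epsilon>\<^sup>2 \<le> real N" using steps(2) by (rule order_trans)
  from regret_high_probability[OF params(1) refl params(3,4) steps(1) this] obtain B where B: "B \<in> sets P" "P.prob B \<le> \<sigma>"
    and regret: "AE \<omega> in P. \<omega> \<notin> B \<longrightarrow> (\<forall>y\<in>Q. (\<Sum>k<N. A (b k \<omega>) (x k \<omega>) \<bullet> (x k \<omega> - y)) \<le> \<epsilon> * real N)"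
    .
  define E where "E = {\<omega> \<in> space P. I \<omega> \<noteq> {} \<and> primal_dual_approx Q f m g \<epsilon> (\<epsilon> + 2 * \<delta>)
    (primal_output (I \<omega>) (\<lambda>k. x k \<omega>)) (dual_output (I \<omega>) (J \<omega>) (\<lambda>k. c k \<omega>))}"
  have b_0: "b k \<omega> = 0 \<longleftrightarrow> productive m g\<^sub>\<delta> \<theta> (x k \<omega>)" if "\<omega> \<in> space P" "k < N" for k \<omega>
    using c_in[OF that] by (auto simp: b_def)
  have I: "I \<omega> = {k. k < N \<and> b k \<omega> = 0}" and J: "J \<omega> = {k. k < N \<and> b k \<omega> \<noteq> 0}" if "\<omega> \<in> space P" for \<omega>
    unfolding I_def J_def productive_steps_def nonproductive_steps_def \<theta>_def[symmetric]
    by (rule Collect_cong, use b_0[OF that] in metis)+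
  have dual: "dual_output (I \<omega>) (J \<omega>) (\<lambda>k. c k \<omega>) = dual_output (I \<omega>) (J \<omega>) (\<lambda>k. b k \<omega>)" for \<omega>
    unfolding dual_output_def
    by (intro ext arg_cong2[where f="(*)"] sum.cong refl)
      (auto simp: J_def nonproductive_steps_def b_def \<theta>_def)
  \<comment> \<open>A nonmeasurable set would have \<open>measure\<close> 0 by convention, so
    measurability of \<open>E\<close> is a real obligation. Written through \<open>b\<close>, the
    index sets and multipliers depend on finitely many discrete variables.\<close>
  have "E = {\<omega> \<in> space P. {k. k < N \<and> b k \<omega> = 0} \<noteq> {} \<and>
      primal_dual_approx Q f m g \<epsilon> (\<epsilon> + 2 * \<delta>) (primal_output {k. k < N \<and> b k \<omega> = 0} (\<lambda>k. x k \<omega>))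
        (dual_output {k. k < N \<and> b k \<omega> = 0} {k. k < N \<and> b k \<omega> \<noteq> 0} (\<lambda>k. b k \<omega>))}"
    unfolding E_def dual by (intro Collect_cong conj_cong refl) (simp_all only: I J)
  also have "\<dots> \<in> sets P"
  proof (rule measurable_primal_dual_event[OF Q(1)])
    show "continuous_on Q f" using lipschitz(1) M by (intro lipschitz_wrt_continuous_on[OF norm]) auto
    show "continuous_on Q (g l)" if "l \<in> {1..m}" for l
      using lipschitz(2)[OF that] M by (intro lipschitz_wrt_continuous_on[OF norm]) auto
    show "b k \<in> measurable P (count_space UNIV)" if "k < N" for k
      using measurable_from_subalg[OF filtration(2) measurable_index[OF that]]
      by (rule measurable_compose) simp
    show "x k \<in> borel_measurable P" if "k < N" for k
      using measurable_from_subalg[OF filtration(2) measurable_x_borel[of k]] that by simp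
    show "x k \<omega> \<in> Q" if "k < N" "\<omega> \<in> space P" for k \<omega>
      using x_in_Q[of \<omega> k] that by simp
  qed
  finally have E: "E \<in> sets P" .
  have "AE \<omega> in P. \<omega> \<in> space P" by simp
  with regret have AE: "AE \<omega> in P. \<omega> \<in> space P - B \<longrightarrow> \<omega> \<in> E"
  proof eventually_elim
    case (elim \<omega>)
    show ?case
    proof
      assume "\<omega> \<in> space P - B"
      then have r: "\<forall>y\<in>Q. (\<Sum>k<N. A (b k \<omega>) (x k \<omega>) \<bullet> (x k \<omega> - y)) \<le> \<epsilon> * real N" using elim by blast
      have "I \<omega> \<noteq> {} \<and> primal_dual_approx Q f m g \<epsilon> (\<epsilon> + 2 * \<delta>)
          (primal_output (I \<omega>) (\<lambda>k. x k \<omega>)) (dual_output (I \<omega>) (J \<omega>) (\<lambda>k. c k \<omega>))"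
        unfolding I_def J_def
      proof (rule primal_dual_approx_of_regret[OF Q(1) convex subgrad_f subgrad_g slater approx steps(1)])
        show "x k \<omega> \<in> Q" if "k < N" for k using x_in_Q[of \<omega> k] elim that by simp
        show "is_arg_max (\<lambda>l. g\<^sub>\<delta> l (x k \<omega>)) (\<lambda>l. l \<in> {1..m}) (c k \<omega>)"
          if "k < N" "\<not> productive m g\<^sub>\<delta> (\<epsilon> + \<delta>) (x k \<omega>)" for k
          using choice[of \<omega> k] elim that unfolding \<theta>_def by blast
        fix y assume "y \<in> Q"
        have "(\<Sum>k<N. (if productive m g\<^sub>\<delta> (\<epsilon> + \<delta>) (x k \<omega>) then gradf (x k \<omega>) else gradg (c k \<omega>) (x k \<omega>)) \<bullet> (x k \<omega> - y))
            = (\<Sum>k<N. A (b k \<omega>) (x k \<omega>) \<bullet> (x k \<omega> - y))"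
        proof (rule sum.cong)
          fix k assume "k \<in> {..<N}"
          then have "productive m g\<^sub>\<delta> \<theta> (x k \<omega>) \<or> c k \<omega> \<noteq> 0" using c_in[of \<omega> k] elim by fastforce
          then show "(if productive m g\<^sub>\<delta> (\<epsilon> + \<delta>) (x k \<omega>) then gradf (x k \<omega>) else gradg (c k \<omega>) (x k \<omega>)) \<bullet> (x k \<omega> - y)
              = A (b k \<omega>) (x k \<omega>) \<bullet> (x k \<omega> - y)"
            by (auto simp: A_def b_def \<theta>_def)
        qed simp
        also have "\<dots> \<le> \<epsilon> * real N" using r \<open>y \<in> Q\<close> by blast
        finally show "(\<Sum>k<N. (if productive m g\<^sub>\<delta> (\<epsilon> + \<delta>) (x k \<omega>) then gradf (x k \<omega>) else gradg (c k \<omega>) (x k \<omega>)) \<bullet> (x k \<omega> - y))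
            \<le> \<epsilon> * real N" .
      qed
      then show "\<omega> \<in> E" using elim unfolding E_def by blast
    qed
  qed
  have "1 - \<sigma> \<le> P.prob (space P - B)" using P.prob_compl[OF B(1)] B(2) by simp
  also have "\<dots> \<le> P.prob E" by (rule P.finite_measure_mono_AE[OF AE E])
  finally show ?thesis unfolding E_def .
qed

end
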